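(* Let $n\ge2$ and $\rho=2/(n+1)$. The function $\mathcal{C}_n$ is locally H\"older continuous with exponent $\rho$ on $(0,1)$, and the function $\phi_n$ is locally H\"older continuous with exponent $\rho$ on $(1,\infty)$. Moreover, $$\phi_n(1+h)-1\asymp_n h^\rho\qquad(h\downarrow0),$$ that is, there are constants $c_n,C_n,h_n>0$ depending only on $n$ such that $c_nh^\rho\le\phi_n(1+h)-1\le C_nh^\rho$ for all $0<h<h_n$. In particular, no exponent larger than $\rho$ gives a pointwise H\"older bound for $\phi_n$ at $1$: for no $\gamma>\rho$ do there exist $C,\varepsilon>0$ with $|\phi_n(t)-\phi_n(1)|\le C|t-1|^\gamma$ for all $|t-1|<\varepsilon$.
   Context: All balls are open Euclidean balls in $\mathbb{R}^n$ with positive radii, and $|\cdot|$ applied to a set denotes Lebesgue measure. For a locally integrable function $f$ on $\mathbb{R}^n$, $$Mf(x)=\sup_{B\ni x}\frac1{|B|}\int_B|f(y)|\,dy,$$ where the supremum is over all balls $B$ containing $x$. For $0<\alpha<1$, $$\mathcal{C}_n(\alpha)=\sup_{0<|E|<\infty}\frac{|\{x\in\mathbb{R}^n: M\mathbf{1}_E(x)>\alpha\}|}{|E|},$$ where the supremum is over measurable $E\subset\mathbb{R}^n$ with $0<|E|<\infty$. The halo function $\phi_n:[0,\infty)\to\mathbb{R}$ is defined by $\phi_n(t)=t$ for $0\le t\le1$ and $\phi_n(t)=\mathcal{C}_n(1/t)$ for $t>1$. A function is locally H\"older continuous with exponent $\rho$ on an open interval if on every compact subinterval $I$ it is finite and satisfies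 $|F(s)-F(t)|\le C_I|s-t|^\rho$ for all $s,t\in I$, for some constant $C_I$. *)

theory Defs
  imports "HOL-Analysis.Analysis"
begin

text \<open>
  The uncentred Hardy--Littlewood maximal function with respect to open Euclidean balls.  All
  quantities that may a priori be infinite are valued in \<^typ>\<open>ennreal\<close>.
\<close>

definition maximal_function :: "(real ^ 'n \<Rightarrow> real) \<Rightarrow> real ^ 'n \<Rightarrow> ennreal" where
  "maximal_function f x =
     (SUP B \<in> {ball c r | c r. 0 < r \<and> x \<in> ball c r}.
        (\<integral>\<^sup>+ y \<in> B. ennreal \<bar>f y\<bar> \<partial>lebesgue) / emeasure lebesgue B)"

text \<open>
  The dimension \<open>n\<close> is \<open>CARD('n)\<close>, passed as a type token.  The superlevel set below is a union
  of open balls, so its \<^const>\<open>emeasure\<close> is its genuine Lebesgue measure.  The paper uses the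
  constant only for \<open>0 < \<alpha> < 1\<close>.
\<close>

definition tauberian_constant :: "'n::finite itself \<Rightarrow> real \<Rightarrow> ennreal" where
  "tauberian_constant (_ :: 'n itself) \<alpha> =
     (SUP E \<in> {E :: (real ^ 'n) set. E \<in> sets lebesgue \<and>
                  0 < emeasure lebesgue E \<and> emeasure lebesgue E < \<infinity>}.
        emeasure lebesgue {x. maximal_function (indicat_real E) x > ennreal \<alpha>}
          / emeasure lebesgue E)"

text \<open>Only arguments \<open>t \<ge> 0\<close> are meaningful.\<close>

definition halo_function :: "'n::finite itself \<Rightarrow> real \<Rightarrow> ennreal" where
  "halo_function N t = (if t \<le> 1 then ennreal t else tauberian_constant N (1 / t))"

text \<open>
  Finiteness is part of the notion, so the conversion \<^const>\<open>enn2real\<close>, which sends \<open>\<infinity>\<close> to \<open>0\<close>,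
  loses nothing.
\<close>

definition locally_holder_on :: "real \<Rightarrow> real set \<Rightarrow> (real \<Rightarrow> ennreal) \<Rightarrow> bool" where
  "locally_holder_on \<rho> S F \<longleftrightarrow>
     (\<forall>a b. {a..b} \<subseteq> S \<longrightarrow>
        (\<forall>t\<in>{a..b}. F t < \<infinity>) \<and>
        (\<exists>C. \<forall>s\<in>{a..b}. \<forall>t\<in>{a..b}.
           \<bar>enn2real (F s) - enn2real (F t)\<bar> \<le> C * \<bar>s - t\<bar> powr \<rho>))"

end

theory Submission
  imports Defs
begin

text \<open>
  Let \<open>H\<close> be a finite union of balls in each of which \<open>E\<close> has density at least \<open>1 - s\<^sup>n\<^sup>+\<^sup>1\<close>; the point is
  to bound \<open>H - E\<close> by a multiple of \<open>s\<^sup>2\<close> times the volume of \<open>H\<close>. Points that are not at relative depth \<open>s\<^sup>2\<close>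
  in any ball are few, because shrinking all balls of a union by the factor \<open>1 - s\<^sup>2\<close> costs at most
  the corresponding homothety factor. A point \<open>x\<close> at depth \<open>s\<^sup>2 r\<close> in a ball of radius \<open>r\<close> and centre \<open>c\<close>
  is covered by the deepest ball at \<open>z\<close> for every \<open>z\<close> in the ellipsoid with foci \<open>x\<close>, \<open>c\<close> and major
  axis \<open>r\<close>, whose volume is of order \<open>s\<^sup>n\<^sup>-\<^sup>1 r\<^sup>n\<close>; averaging over \<open>z\<close> gives the bound with
  \<open>s\<^sup>n\<^sup>+\<^sup>1 / s\<^sup>n\<^sup>-\<^sup>1 = s\<^sup>2\<close> at one dyadic scale, and a Vitali selection makes the scales summable.
  The opposite bound comes from balls protruding slightly from a face of a cube.

  Hoelder continuity follows by iteration: passing from \<open>E\<close> to its halo at level \<open>1 - \<delta>\<close> multiplies its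
  density in every ball by a factor of at least \<open>1 + c \<delta>\<close>, unless the density is already close to 1,
  hence \<open>C(\<alpha>) \<le> C(1 - \<delta>) C((1 + c \<delta>) \<alpha>)\<close>.
\<close>

section \<open>Geometry of unions of balls\<close>

abbreviation vol :: "'a::euclidean_space set \<Rightarrow> real" where
  "vol \<equiv> measure lebesgue"

abbreviation ball_vol :: "'a::euclidean_space itself \<Rightarrow> real" where
  "ball_vol _ \<equiv> unit_ball_vol (real DIM('a))"

lemma vol_ball:
  fixes c :: "'a::euclidean_space"
  assumes "0 \<le> r"
  shows "vol (ball c r) = ball_vol TYPE('a) * r ^ DIM('a)"
  using content_ball[OF assms, of c] by (simp add: measure_completion)

text \<open>Ties are broken by an enumeration of \<open>I\<close>: a point goes to the minimiser
  with the smallest number, which makes the cells disjoint and keeps them Borel. With powers of a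
  point this gives the power diagram of a family of balls; with \<open>dist z (c i) - r i\<close> it
  selects the ball in which \<open>z\<close> lies deepest.\<close>

lemma argmin_partition:
  fixes f :: "'i \<Rightarrow> 'a::euclidean_space \<Rightarrow> real"
  assumes I: "finite I" "I \<noteq> {}" and f: "\<And>i. i \<in> I \<Longrightarrow> f i \<in> borel_measurable borel"
  obtains P where "\<And>i. i \<in> I \<Longrightarrow> P i \<in> sets borel" "disjoint_family_on P I"
    "(\<Union>i\<in>I. P i) = UNIV" "\<And>i j z. \<lbrakk>i \<in> I; j \<in> I; z \<in> P i\<rbrakk> \<Longrightarrow> f i z \<le> f j z"
proof
  define g where "g = to_nat_on I"
  have inj: "inj_on g I"
    unfolding g_def using I by (intro inj_on_to_nat_on countable_finite)
  define S where "S i = {z. \<forall>j\<in>I. f i z \<le> f j z}" for i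
  define P where "P i = S i - (\<Union>j\<in>{j\<in>I. g j < g i}. S j)" for i
  have S: "S i \<in> sets borel" if "i \<in> I" for i
  proof -
    have "S i = (\<Inter>j\<in>I. {z \<in> space borel. f i z \<le> f j z})"
      unfolding S_def using I by auto
    moreover have "{z \<in> space borel. f i z \<le> f j z} \<in> sets borel" if "j \<in> I" for j
      using f[OF \<open>i \<in> I\<close>] f[OF that] by (intro borel_measurable_le) auto
    ultimately show ?thesis
      using I by (auto intro!: sets.finite_INT)
  qed
  show "P i \<in> sets borel" if "i \<in> I" for i
    unfolding P_def using S that I by (intro sets.Diff sets.finite_UN) auto
  show "disjoint_family_on P I"
    unfolding disjoint_family_on_def P_def using inj
    by (auto simp: inj_on_def) (metis nat_neq_iff)
  show "f i z \<le> f j z" if "i \<in> I" "j \<in> I" "z \<in> P i" for i j z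
    using that unfolding P_def S_def by auto
  have "\<exists>i\<in>I. z \<in> P i" for z
  proof -
    have "\<exists>i\<in>I. \<forall>j\<in>I. f i z \<le> f j z"
      using arg_min_if_finite[OF I, of "\<lambda>i. f i z"] by (metis leI)
    then have "\<exists>i. i \<in> I \<and> z \<in> S i"
      by (auto simp: S_def)
    then obtain i where "i \<in> I" "z \<in> S i" "\<And>j. j \<in> I \<Longrightarrow> z \<in> S j \<Longrightarrow> g i \<le> g j"
      using exists_least_iff[of "\<lambda>n. \<exists>i. i \<in> I \<and> z \<in> S i \<and> n = g i"]
      by (metis (mono_tags, lifting) leI)
    then show ?thesis
      unfolding P_def by (intro bexI[of _ i]) (auto simp: not_le[symmetric])
  qed
  then show "(\<Union>i\<in>I. P i) = UNIV"
    by auto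
qed

text \<open>
  Contracting every power-diagram cell towards its own centre keeps the cells disjoint, because the
  difference of two powers is an affine function.
\<close>
lemma vol_Union_shrunk_balls:
  fixes c :: "'i \<Rightarrow> 'a::euclidean_space"
  assumes I: "finite I" and r: "\<And>i. i \<in> I \<Longrightarrow> 0 < r i" and t: "0 < t" "t \<le> 1"
  shows "t ^ DIM('a) * vol (\<Union>i\<in>I. ball (c i) (r i)) \<le> vol (\<Union>i\<in>I. ball (c i) (t * r i))"
proof (cases "I = {}")
  case False
  define H where "H = (\<Union>i\<in>I. ball (c i) (r i))"
  have H: "H \<in> lmeasurable" "H \<in> sets borel"
    unfolding H_def using I by (auto intro!: fmeasurable.finite_UN)
  obtain P where P: "\<And>i. i \<in> I \<Longrightarrow> P i \<in> sets borel" "disjoint_family_on P I"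
    "(\<Union>i\<in>I. P i) = UNIV"
    "\<And>i j z. \<lbrakk>i \<in> I; j \<in> I; z \<in> P i\<rbrakk> \<Longrightarrow> (dist z (c i))\<^sup>2 - (r i)\<^sup>2 \<le> (dist z (c j))\<^sup>2 - (r j)\<^sup>2"
    by (rule argmin_partition[OF I False, of "\<lambda>i z. (dist z (c i))\<^sup>2 - (r i)\<^sup>2"]) (auto, measurable)
  define T where "T i z = t *\<^sub>R z + (1 - t) *\<^sub>R c i" for i z
  define A where "A i = P i \<inter> H" for i
  have A: "A i \<in> sets borel" "A i \<in> lmeasurable" if "i \<in> I" for i
    unfolding A_def using P(1)[OF that] H
    by (auto simp: Int_commute intro!: fmeasurable_Int_fmeasurable)
  \<comment> \<open>A point of the union has negative power with respect to some ball, hence also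
    with respect to the ball of its own cell, where the power is least.\<close>
  have A_ball: "A i \<subseteq> ball (c i) (r i)" if i: "i \<in> I" for i
  proof
    fix z assume "z \<in> A i"
    then obtain j where j: "j \<in> I" "dist z (c j) < r j" "z \<in> P i"
      unfolding A_def H_def by (auto simp: dist_commute)
    have "(dist z (c j))\<^sup>2 < (r j)\<^sup>2"
      using j by (intro power_strict_mono) auto
    then have "(dist z (c i))\<^sup>2 < (r i)\<^sup>2"
      using P(4)[OF i j(1) j(3)] by linarith
    then show "z \<in> ball (c i) (r i)"
      using r[OF i] by (auto simp: dist_commute intro: power2_less_imp_less)
  qed
  have T_ball: "T i ` A i \<subseteq> ball (c i) (t * r i)" if i: "i \<in> I" for i
  proof
    fix w assume "w \<in> T i ` A i"
    then obtain z where z: "dist z (c i) < r i" "w = T i z"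
      using A_ball[OF i] by (auto simp: dist_commute)
    have "w - c i = t *\<^sub>R (z - c i)"
      unfolding z T_def by (simp add: algebra_simps)
    then have "dist w (c i) = t * dist z (c i)"
      using t by (simp add: dist_norm)
    then show "w \<in> ball (c i) (t * r i)"
      using z t by (simp add: dist_commute)
  qed
  have vol_T: "T i ` A i \<in> lmeasurable" "vol (T i ` A i) = t ^ DIM('a) * vol (A i)" if i: "i \<in> I" for i
  proof -
    show "vol (T i ` A i) = t ^ DIM('a) * vol (A i)"
      unfolding T_def using measure_lebesgue_affine[of t "(1 - t) *\<^sub>R c i" "A i"] t by simp
    have "T i ` A i = (\<lambda>w. (1 / t) *\<^sub>R (w - (1 - t) *\<^sub>R c i)) -` A i \<inter> space borel"
      unfolding T_def using t by (auto simp: image_iff intro!: bexI[rotated])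
    also have "\<dots> \<in> sets borel"
      using A(1)[OF i] by (intro measurable_sets[of _ borel borel]) auto
    finally show "T i ` A i \<in> lmeasurable"
      using T_ball[OF i] by (intro fmeasurableI2[OF lmeasurable_ball]) auto
  qed
  have disj: "T i ` A i \<inter> T j ` A j = {}" if ij: "i \<in> I" "j \<in> I" "i \<noteq> j" for i j
  proof (rule ccontr)
    assume "T i ` A i \<inter> T j ` A j \<noteq> {}"
    then obtain x y where xy: "x \<in> P i" "y \<in> P j" "T i x = T j y"
      unfolding A_def by auto
    define k where "k = (1 - t) / t"
    have "x \<noteq> y"
      using P(2) ij xy(1,2) unfolding disjoint_family_on_def by blast
    have "t *\<^sub>R (x - y) = (1 - t) *\<^sub>R (c j - c i)"
      using xy(3) unfolding T_def by (simp add: algebra_simps)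
    then have eq: "x - y = k *\<^sub>R (c j - c i)"
      unfolding k_def using t
      by (metis (no_types, opaque_lifting) divide_inverse_commute less_numeral_extra(3) real_vector_affinity_eq
          scaleR_scaleR scaleR_one left_inverse)
    have "k \<noteq> 0" "c i \<noteq> c j"
      using \<open>x \<noteq> y\<close> eq by auto
    moreover have "0 \<le> k"
      unfolding k_def using t by simp
    ultimately have "0 < k" "c i \<noteq> c j"
      by auto
    \<comment> \<open>The radii cancel when the two cell inequalities are added. By
      \<open>eq\<close>, \<open>x\<close> is displaced from \<open>y\<close> towards
      \<open>c j\<close>, so it should favour \<open>j\<close> more than \<open>y\<close> does; yet
      \<open>x\<close> lies in cell \<open>i\<close> and \<open>y\<close> in cell
      \<open>j\<close>.\<close>
    have "(dist x (c j))\<^sup>2 - (dist x (c i))\<^sup>2 - ((dist y (c j))\<^sup>2 - (dist y (c i))\<^sup>2) \<ge> 0"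
      using P(4)[OF ij(1,2) xy(1)] P(4)[OF ij(2,1) xy(2)] by linarith
    also have "(dist x (c j))\<^sup>2 - (dist x (c i))\<^sup>2 - ((dist y (c j))\<^sup>2 - (dist y (c i))\<^sup>2)
        = -2 * ((x - y) \<bullet> (c j - c i))"
      by (simp add: dist_norm power2_norm_eq_inner inner_diff inner_commute algebra_simps)
    also have "\<dots> = -2 * k * (norm (c j - c i))\<^sup>2"
      unfolding eq by (simp add: power2_norm_eq_inner)
    also have "\<dots> < 0"
      using \<open>0 < k\<close> \<open>c i \<noteq> c j\<close> by auto
    finally show False by simp
  qed
  have "t ^ DIM('a) * vol H = t ^ DIM('a) * vol (\<Union>i\<in>I. A i)"
    using P(3) by (simp add: A_def flip: Int_UN_distrib2)
  also have "\<dots> \<le> (\<Sum>i\<in>I. t ^ DIM('a) * vol (A i))"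
    unfolding sum_distrib_left[symmetric] using A t I
    by (intro mult_left_mono measure_UNION_le) auto
  also have "\<dots> = (\<Sum>i\<in>I. vol (T i ` A i))"
    using vol_T by (intro sum.cong) auto
  also have "\<dots> = vol (\<Union>i\<in>I. T i ` A i)"
    using I vol_T disj by (intro measure_UNION'[symmetric]) (auto simp: pairwise_def disjnt_def)
  also have "\<dots> \<le> vol (\<Union>i\<in>I. ball (c i) (t * r i))"
    using T_ball I vol_T by (intro measure_mono_fmeasurable) (auto intro!: fmeasurable.finite_UN)
  finally show ?thesis
    unfolding H_def .
qed auto

section \<open>Ellipsoids given by their foci\<close>

text \<open>With \<open>a\<close> the claimed increment, the square of \<open>norm (w + u)\<close>
  falls short of that of \<open>norm w + a\<close> by the square of \<open>a\<close>; Cauchy-Schwarz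
  makes \<open>norm w + a\<close> nonnegative, so roots may be compared. For a sum of distances to
  two foci, the linear terms cancel at points between the foci and only second-order errors
  remain.\<close>

lemma norm_add_le_second_order:
  fixes u w :: "'a::euclidean_space"
  assumes "0 < norm w"
  shows "norm (w + u) \<le> norm w + (w \<bullet> u) / norm w + (norm u)\<^sup>2 / (2 * norm w)"
proof -
  define a where "a = (w \<bullet> u) / norm w + (norm u)\<^sup>2 / (2 * norm w)"
  have *: "2 * norm w * a = 2 * (w \<bullet> u) + (norm u)\<^sup>2"
    unfolding a_def using assms by (simp add: field_simps)
  have "(norm (w + u))\<^sup>2 = (norm w)\<^sup>2 + 2 * (w \<bullet> u) + (norm u)\<^sup>2"
    by (simp add: power2_norm_eq_inner inner_add inner_commute)
  also have "\<dots> = (norm w)\<^sup>2 + 2 * norm w * a"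
    using * by simp
  also have "\<dots> \<le> (norm w + a)\<^sup>2"
    by (simp add: power2_sum)
  finally have le: "(norm (w + u))\<^sup>2 \<le> (norm w + a)\<^sup>2" .
  have "\<bar>w \<bullet> u\<bar> \<le> norm w * norm u"
    by (rule Cauchy_Schwarz_ineq2)
  then have "- (norm w * norm u) \<le> w \<bullet> u"
    by linarith
  then have "2 * norm w * (norm w + a) \<ge> 2 * (norm w)\<^sup>2 - 2 * (norm w * norm u) + (norm u)\<^sup>2"
    unfolding distrib_left * power2_eq_square by linarith
  also have "2 * (norm w)\<^sup>2 - 2 * (norm w * norm u) + (norm u)\<^sup>2 = (norm w)\<^sup>2 + (norm w - norm u)\<^sup>2"
    by (simp add: power2_eq_square algebra_simps)
  finally have "2 * norm w * (norm w + a) \<ge> 0"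
    by (smt (verit) zero_le_power2)
  then have "norm w + a \<ge> 0"
    using assms mult_pos_neg[of "2 * norm w" "norm w + a"] by linarith
  from power2_le_imp_le[OF le this] show ?thesis
    unfolding a_def by linarith
qed

text \<open>
  The ellipsoid with foci \<open>x\<close> and \<open>c\<close> has minor axes of length about \<open>s * r\<close>; the bound comes from
  about \<open>1 / s\<close> disjoint balls of radius \<open>s * r / 12\<close> strung along the major axis.
\<close>
lemma vol_ellipsoid_ge:
  fixes x c :: "'a::euclidean_space"
  assumes s: "0 < s" "s \<le> 1" and r: "0 < r" and x: "dist x c \<le> (1 - s\<^sup>2) * r"
  shows "ball_vol TYPE('a) / (2 * 12 ^ DIM('a)) * s ^ (DIM('a) - 1) * r ^ DIM('a)
    \<le> vol {z. dist x z + dist z c < r}"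
proof -
  define E where "E = {z. dist x z + dist z c < r}"
  define b where "b = r * s / 12"
  define N where "N = nat \<lfloor>1 / s\<rfloor>"
  have b: "0 < b"
    unfolding b_def using s r by simp
  have N: "1 / (2 * s) \<le> real N" "real N \<le> 1 / s"
  proof -
    have "1 \<le> 1 / s" using s by simp
    then have "1 \<le> \<lfloor>1 / s\<rfloor>" by linarith
    then have "int N = \<lfloor>1 / s\<rfloor>" "1 \<le> int N"
      unfolding N_def using s by simp_all
    then have "real N = real_of_int \<lfloor>1 / s\<rfloor>" "1 \<le> real N"
      by linarith+
    then have "real N \<le> 1 / s" "1 / s < real N + 1" "1 \<le> real N"
      by linarith+
    moreover have "1 / (2 * s) = (1 / s) / 2" by simp
    ultimately show "1 / (2 * s) \<le> real N" "real N \<le> 1 / s"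
      by linarith+
  qed
  define d where "d = dist x c"
  \<comment> \<open>If the foci coincide then \<open>d = 0\<close>, and any unit vector serves as
    the axis.\<close>
  obtain e where e: "norm e = 1" "x - c = d *\<^sub>R e"
  proof (cases "x = c")
    case True
    show ?thesis
      using that[of "SOME e. e \<in> Basis"] True by (simp add: d_def some_in_eq)
  next
    case False
    then show ?thesis
      using that[of "(1 / d) *\<^sub>R (x - c)"] by (simp add: d_def dist_norm)
  qed
  have d: "0 \<le> d" "d \<le> (1 - s\<^sup>2) * r"
    using x by (auto simp: d_def)
  \<comment> \<open>The centres sit on the axis at spacing \<open>2 * b\<close>, so the balls of
    radius \<open>b\<close> are disjoint. Since \<open>2 * b / s = r / 6\<close>, the first
    \<open>N\<close> of them stay at distance between \<open>r / 6\<close> and \<open>r / 3\<close>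
    from \<open>c\<close>.\<close>
  define t where "t l = r / 6 + 2 * b * real l" for l :: nat
  define p where "p l = c + t l *\<^sub>R e" for l
  have t: "r / 6 \<le> t l" "t l \<le> r / 3" if "l < N" for l
  proof -
    show "r / 6 \<le> t l" unfolding t_def using b by simp
    have "2 * b * real l \<le> 2 * b * (1 / s)"
      using that N b by (intro mult_left_mono) auto
    also have "\<dots> = r / 6"
      unfolding b_def using s by simp
    finally show "t l \<le> r / 3"
      unfolding t_def by simp
  qed
  have sub: "ball (p l) b \<subseteq> E" if l: "l < N" for l
  proof
    fix z assume z: "z \<in> ball (p l) b"
    define u where "u = z - p l"
    have u: "norm u < b"
      using z by (simp add: u_def dist_norm norm_minus_commute)
    have zc: "z - c = t l *\<^sub>R e + u" and zx: "z - x = (t l - d) *\<^sub>R e + u"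
      using e(2) by (auto simp: u_def p_def algebra_simps)
    have t0: "0 < t l" "r / 6 \<le> t l" "t l \<le> r / 3"
      using t[OF l] r by auto
    have "dist x z + dist z c < r"
    \<comment> \<open>If the centre is also at distance at least \<open>r / 6\<close> from
      \<open>x\<close>, the terms \<open>e \<bullet> u\<close> cancel and the two errors
      \<open>r * s\<^sup>2 / 48\<close> fit into the slack \<open>s\<^sup>2 * r\<close> left by
      \<open>d\<close>. Otherwise the centre has distance sum at most \<open>2 * r / 3\<close>, and
      the triangle inequality suffices.\<close>
    proof (cases "d \<ge> t l + r / 6")
      case True
      have u2: "(norm u)\<^sup>2 \<le> r\<^sup>2 * s\<^sup>2 / 144"
      proof -
        have "(norm u)\<^sup>2 \<le> b\<^sup>2"
          using u by (intro power_mono) auto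
        then show ?thesis
          by (simp add: b_def power_divide power_mult_distrib)
      qed
      have small: "(norm u)\<^sup>2 / (2 * a) \<le> r * s\<^sup>2 / 48" if a: "r / 6 \<le> a" for a
      proof -
        have "(norm u)\<^sup>2 / (2 * a) \<le> (r\<^sup>2 * s\<^sup>2 / 144) / (r / 3)"
          using u2 a r by (intro frac_le) auto
        also have "\<dots> = r * s\<^sup>2 / 48"
          using r by (simp add: power2_eq_square)
        finally show ?thesis .
      qed
      have "dist z c = norm (t l *\<^sub>R e + u)"
        by (simp add: dist_norm zc)
      also have "\<dots> \<le> t l + e \<bullet> u + (norm u)\<^sup>2 / (2 * t l)"
        using norm_add_le_second_order[of "t l *\<^sub>R e" u] t0 e(1) by simp
      finally have 1: "dist z c \<le> t l + e \<bullet> u + r * s\<^sup>2 / 48"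
        using small[of "t l"] t0 by linarith
      have dt: "d - t l \<ge> r / 6" "0 < d - t l" using True r by auto
      have "dist x z = norm ((d - t l) *\<^sub>R e + (- u))"
        using zx by (metis add_uminus_conv_diff dist_commute dist_norm minus_add_distrib minus_diff_eq norm_minus_cancel scaleR_minus_left)
      also have "\<dots> \<le> (d - t l) - e \<bullet> u + (norm u)\<^sup>2 / (2 * (d - t l))"
        using norm_add_le_second_order[of "(d - t l) *\<^sub>R e" "- u"] dt e(1) by simp
      finally have 2: "dist x z \<le> (d - t l) - e \<bullet> u + r * s\<^sup>2 / 48"
        using small[of "d - t l"] dt by linarith
      have "0 < r * s\<^sup>2" using r s by simp
      then show ?thesis
        using 1 2 d(2) by (simp add: algebra_simps)
    next
      case False
      have "dist z c \<le> t l + norm u" "dist x z \<le> \<bar>t l - d\<bar> + norm u"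
        using norm_triangle_ineq[of "t l *\<^sub>R e" u] norm_triangle_ineq[of "(t l - d) *\<^sub>R e" u] zc zx e(1) t0
        by (auto simp: dist_norm norm_minus_commute[of x z])
      moreover have "b \<le> r / 12"
        unfolding b_def using s r by simp
      moreover have "\<bar>t l - d\<bar> + t l \<le> 2 * r / 3"
        using False d t0 r by (auto simp: abs_if)
      ultimately show ?thesis
        using u r by linarith
    qed
    then show "z \<in> E" by (simp add: E_def)
  qed
  have disj: "ball (p l) b \<inter> ball (p m) b = {}" if "l \<noteq> m" for l m
  proof (rule disjoint_ballI)
    have "dist (p l) (p m) = \<bar>t l - t m\<bar>"
      using e(1) by (simp add: p_def dist_norm flip: scaleR_diff_left)
    also have "\<dots> = 2 * b * \<bar>real l - real m\<bar>"
      unfolding t_def using b by (simp flip: right_diff_distrib) (simp add: abs_mult)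
    also have "\<dots> \<ge> 2 * b * 1"
      using that b by (intro mult_left_mono) auto
    finally show "b + b \<le> dist (p l) (p m)" by simp
  qed
  have E: "E \<in> lmeasurable"
  proof (rule lmeasurable_open)
    show "open E"
      unfolding E_def by (intro open_Collect_less continuous_intros)
    show "bounded E"
    proof (rule bounded_subset[OF bounded_ball])
      show "E \<subseteq> ball c r"
      proof
        fix z assume "z \<in> E"
        then have "dist x z + dist z c < r"
          by (simp add: E_def)
        then show "z \<in> ball c r"
          using zero_le_dist[of x z] dist_commute[of c z] unfolding mem_ball by linarith
      qed
    qed
  qed
  have n: "s ^ DIM('a) = s * s ^ (DIM('a) - 1)"
    by (simp flip: power_Suc)
  have "b ^ DIM('a) = s * (s ^ (DIM('a) - 1) * r ^ DIM('a) / 12 ^ DIM('a))"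
    unfolding b_def power_divide power_mult_distrib unfolding n by simp
  then have "ball_vol TYPE('a) / (2 * 12 ^ DIM('a)) * s ^ (DIM('a) - 1) * r ^ DIM('a)
      = 1 / (2 * s) * (ball_vol TYPE('a) * b ^ DIM('a))"
    using s by simp
  also have "\<dots> \<le> real N * (ball_vol TYPE('a) * b ^ DIM('a))"
    using N b by (intro mult_right_mono) auto
  also have "\<dots> = (\<Sum>l<N. vol (ball (p l) b))"
    by (simp only: vol_ball[OF less_imp_le[OF b]] sum_constant card_lessThan)
  also have "\<dots> = vol (\<Union>l<N. ball (p l) b)"
    using disj by (intro measure_UNION'[symmetric]) (auto simp: pairwise_def disjnt_def)
  also have "\<dots> \<le> vol E"
    using sub E by (intro measure_mono_fmeasurable) auto
  finally show ?thesis
    unfolding E_def .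
qed

section \<open>The thin part of a union of balls\<close>

text \<open>The pointwise bound is integrated over \<open>A\<close>. The weights \<open>w j\<close>
  make this a weighted count of overlaps.\<close>

lemma vol_mult_le_sum_cover:
  fixes B :: "'i \<Rightarrow> 'a::euclidean_space set"
  assumes J: "finite J" and A: "A \<in> lmeasurable" and B: "\<And>j. j \<in> J \<Longrightarrow> B j \<in> sets lebesgue"
    and le: "\<And>x. x \<in> A \<Longrightarrow> m \<le> (\<Sum>j\<in>{j\<in>J. x \<in> B j}. w j)"
  shows "m * vol A \<le> (\<Sum>j\<in>J. w j * vol (A \<inter> B j))"
proof -
  have AB: "A \<inter> B j \<in> lmeasurable" if "j \<in> J" for j
    using A B[OF that] by (rule fmeasurable_Int_fmeasurable)
  have int: "integrable lebesgue (indicat_real S)" if "S \<in> lmeasurable" for S :: "'a set"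
    using that by (intro integrable_real_indicator) (auto simp: fmeasurable_def)
  have "m * vol A = (\<integral>x. m * indicat_real A x \<partial>lebesgue)"
    using A by simp
  also have "\<dots> \<le> (\<integral>x. (\<Sum>j\<in>J. w j * indicat_real (A \<inter> B j) x) \<partial>lebesgue)"
  proof (rule integral_mono)
    show "m * indicat_real A x \<le> (\<Sum>j\<in>J. w j * indicat_real (A \<inter> B j) x)" for x
    proof (cases "x \<in> A")
      case True
      have "(\<Sum>j\<in>{j\<in>J. x \<in> B j}. w j) = (\<Sum>j\<in>J. w j * indicat_real (A \<inter> B j) x)"
        using J True by (simp add: sum.If_cases indicator_def Int_def if_distrib[of "\<lambda>t. _ * t"] cong: if_cong)
      then show ?thesis
        using le[OF True] True by simp
    qed simp
  qed (use A AB int in auto)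
  also have "\<dots> = (\<Sum>j\<in>J. w j * vol (A \<inter> B j))"
    using AB int by (subst Bochner_Integration.integral_sum) auto
  finally show ?thesis .
qed

text \<open>
  Each \<open>z \<in> Z\<close> selects the ball in which it lies deepest. If \<open>x\<close> lies at relative depth \<open>s\<^sup>2\<close> in
  some ball \<open>B\<close>, then \<open>x\<close> belongs to the ball selected by any \<open>z\<close> in the ellipsoid with foci \<open>x\<close> and
  the centre of \<open>B\<close>; averaging over \<open>z\<close> replaces a choice of a sparse subcover.
\<close>
lemma single_scale_estimate:
  fixes c :: "'i \<Rightarrow> 'a::euclidean_space"
  assumes I: "finite I" and R: "0 < R" and r: "\<And>i. i \<in> I \<Longrightarrow> R \<le> r i \<and> r i \<le> 2 * R"
    and s: "0 < s" "s \<le> 1" and D: "D \<in> sets lebesgue" and A: "A \<in> sets lebesgue" and Z: "Z \<in> lmeasurable"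
    and \<delta>: "0 \<le> \<delta>" and thin: "\<And>i. i \<in> I \<Longrightarrow> vol (D \<inter> ball (c i) (r i)) \<le> \<delta> * vol (ball (c i) (r i))"
    and deep: "\<And>x. x \<in> A \<Longrightarrow>
      \<exists>i\<in>I. dist x (c i) \<le> (1 - s\<^sup>2) * r i \<and> {z. dist x z + dist z (c i) < r i} \<subseteq> Z"
  shows "s ^ (DIM('a) - 1) * vol (D \<inter> A) \<le> \<delta> * (2 * 24 ^ DIM('a)) * vol Z"
proof (cases "I = {}")
  case True
  then have "A = {}" using deep by auto
  then have "vol (D \<inter> A) = 0" by simp
  then show ?thesis using \<delta> by simp
next
  case False
  define n where "n = DIM('a)"
  define \<omega> where "\<omega> = ball_vol TYPE('a)"
  have \<omega>: "0 < \<omega>" unfolding \<omega>_def by simp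
  have r0: "0 < r i" if "i \<in> I" for i
    using r[OF that] R by linarith
  obtain P where P: "\<And>i. i \<in> I \<Longrightarrow> P i \<in> sets borel" "disjoint_family_on P I"
    "(\<Union>i\<in>I. P i) = UNIV"
    "\<And>i j z. \<lbrakk>i \<in> I; j \<in> I; z \<in> P i\<rbrakk> \<Longrightarrow> dist z (c i) - r i \<le> dist z (c j) - r j"
    by (rule argmin_partition[OF I False, of "\<lambda>i z. dist z (c i) - r i"]) (auto, measurable)
  have PZ: "Z \<inter> P i \<in> lmeasurable" if "i \<in> I" for i
    using Z P(1)[OF that] by (intro fmeasurable_Int_fmeasurable) auto
  have A_ball: "A \<subseteq> (\<Union>i\<in>I. ball (c i) (r i))"
  proof
    fix x assume "x \<in> A"
    then obtain i where i: "i \<in> I" "dist x (c i) \<le> (1 - s\<^sup>2) * r i" using deep by blast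
    have "(1 - s\<^sup>2) * r i < 1 * r i"
      using s r0[OF i(1)] by (intro mult_strict_right_mono) auto
    then have "x \<in> ball (c i) (r i)"
      using i(2) by (simp add: dist_commute)
    then show "x \<in> (\<Union>i\<in>I. ball (c i) (r i))" using i(1) by blast
  qed
  have DA: "D \<inter> A \<in> lmeasurable"
    using A_ball D A I by (intro fmeasurableI2[where B = "D \<inter> A" and A = "\<Union>i\<in>I. ball (c i) (r i)"])
      (auto intro!: fmeasurable.finite_UN)
  \<comment> \<open>A lower bound for the volumes of all ellipsoids at this scale, obtained from
    \<open>R \<le> r i\<close>.\<close>
  define m where "m = \<omega> / (2 * 12 ^ n) * s ^ (n - 1) * R ^ n"
  have "m * vol (D \<inter> A) \<le> (\<Sum>j\<in>I. vol (Z \<inter> P j) * vol (D \<inter> A \<inter> ball (c j) (r j)))"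
  proof (rule vol_mult_le_sum_cover[OF I DA])
    fix x assume "x \<in> D \<inter> A"
    then obtain i where i: "i \<in> I" "dist x (c i) \<le> (1 - s\<^sup>2) * r i"
      "{z. dist x z + dist z (c i) < r i} \<subseteq> Z" using deep by blast
    define E where "E = {z. dist x z + dist z (c i) < r i}"
    define J where "J = {j \<in> I. x \<in> ball (c j) (r j)}"
    have J: "finite J" "J \<subseteq> I" using I by (auto simp: J_def)
    \<comment> \<open>If \<open>z\<close> lies in cell \<open>j\<close>, its depth in ball
      \<open>j\<close> is at least its depth in ball \<open>i\<close>, which exceeds
      \<open>dist x z\<close>; hence \<open>x\<close> also lies in ball \<open>j\<close>.\<close>
    have "E \<subseteq> (\<Union>j\<in>J. Z \<inter> P j)"
    proof
      fix z assume z: "z \<in> E"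
      obtain j where j: "j \<in> I" "z \<in> P j" using P(3) by blast
      have "dist z (c j) - r j \<le> dist z (c i) - r i"
        using P(4)[OF j(1) i(1) j(2)] .
      then have "dist x (c j) < r j"
        using z dist_triangle[of x "c j" z] unfolding E_def by simp
      then show "z \<in> (\<Union>j\<in>J. Z \<inter> P j)"
        using j z i(3) unfolding J_def E_def by (auto simp: dist_commute)
    qed
    moreover have "open E"
      unfolding E_def by (intro open_Collect_less continuous_intros)
    then have "E \<in> sets lebesgue"
      by simp
    ultimately have "vol E \<le> vol (\<Union>j\<in>J. Z \<inter> P j)"
      using J PZ by (intro measure_mono_fmeasurable fmeasurable.finite_UN) auto
    also have "\<dots> \<le> (\<Sum>j\<in>J. vol (Z \<inter> P j))"
      using J PZ by (intro measure_UNION_le) auto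
    finally have "vol E \<le> (\<Sum>j\<in>J. vol (Z \<inter> P j))" .
    moreover have "m \<le> \<omega> / (2 * 12 ^ n) * s ^ (n - 1) * r i ^ n"
      unfolding m_def using \<omega> s r[OF i(1)] R by (intro mult_left_mono power_mono) auto
    moreover have "\<omega> / (2 * 12 ^ n) * s ^ (n - 1) * r i ^ n \<le> vol E"
      unfolding E_def n_def \<omega>_def using i(2) s r0[OF i(1)] by (intro vol_ellipsoid_ge)
    ultimately show "m \<le> (\<Sum>j\<in>{j\<in>I. x \<in> ball (c j) (r j)}. vol (Z \<inter> P j))"
      unfolding J_def by linarith
  qed auto
  also have "\<dots> \<le> (\<Sum>j\<in>I. vol (Z \<inter> P j) * (\<delta> * (\<omega> * (2 * R) ^ n)))"
  proof (intro sum_mono mult_left_mono)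
    fix j assume j: "j \<in> I"
    have "vol (D \<inter> A \<inter> ball (c j) (r j)) \<le> vol (D \<inter> ball (c j) (r j))"
      using D A by (intro measure_mono_fmeasurable) (auto intro!: fmeasurableI2[OF lmeasurable_ball Int_lower2])
    also have "\<dots> \<le> \<delta> * vol (ball (c j) (r j))" using thin[OF j] .
    also have "\<dots> = \<delta> * (\<omega> * r j ^ n)"
      unfolding \<omega>_def n_def by (simp only: vol_ball[OF less_imp_le[OF r0[OF j]]])
    also have "\<dots> \<le> \<delta> * (\<omega> * (2 * R) ^ n)"
      using \<delta> \<omega> r[OF j] r0[OF j] by (intro mult_left_mono power_mono) auto
    finally show "vol (D \<inter> A \<inter> ball (c j) (r j)) \<le> \<delta> * (\<omega> * (2 * R) ^ n)" .
  qed auto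
  also have "\<dots> = \<delta> * (\<omega> * (2 * R) ^ n) * (\<Sum>j\<in>I. vol (Z \<inter> P j))"
    unfolding sum_distrib_left by (intro sum.cong refl mult.commute)
  also have "(\<Sum>j\<in>I. vol (Z \<inter> P j)) = vol (\<Union>j\<in>I. Z \<inter> P j)"
    using I PZ P(2) by (intro measure_UNION'[symmetric]) (auto simp: pairwise_def disjnt_def disjoint_family_on_def)
  also have "(\<Union>j\<in>I. Z \<inter> P j) = Z"
    using P(3) by auto
  finally have "m * vol (D \<inter> A) \<le> \<delta> * (\<omega> * (2 * R) ^ n) * vol Z" .
  moreover have "m = (\<omega> * R ^ n / (2 * 12 ^ n)) * s ^ (n - 1)"
    unfolding m_def by simp
  \<comment> \<open>The base \<open>24\<close> is \<open>12 * 2\<close>: the \<open>12\<close> comes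
    from the ellipsoid bound, the \<open>2\<close> from the spread of radii within one
    scale.\<close>
  moreover have "\<delta> * (\<omega> * (2 * R) ^ n) * vol Z = (\<omega> * R ^ n / (2 * 12 ^ n)) * (\<delta> * (2 * 24 ^ n) * vol Z)"
  proof -
    have "(24::real) ^ n = 12 ^ n * 2 ^ n" by (simp flip: power_mult_distrib)
    then show ?thesis by (simp add: power_mult_distrib)
  qed
  ultimately have "(\<omega> * R ^ n / (2 * 12 ^ n)) * (s ^ (n - 1) * vol (D \<inter> A))
      \<le> (\<omega> * R ^ n / (2 * 12 ^ n)) * (\<delta> * (2 * 24 ^ n) * vol Z)"
    by (simp only: mult.assoc)
  then show ?thesis
    unfolding n_def[symmetric] by (rule mult_left_le_imp_le) (use \<omega> R in simp)
qed

section \<open>Vitali selection, annuli and geometric sums\<close>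

text \<open>The selection is made among closed balls: two that meet have centres no further apart
  than the sum of their radii. This and the comparison of radii are recorded besides the usual
  inclusion, because they confine the balls of one scale to annuli around selected balls.\<close>

lemma Vitali_finite_balls:
  fixes c :: "'i \<Rightarrow> 'a::euclidean_space"
  assumes I: "finite I" and r: "\<And>i. i \<in> I \<Longrightarrow> 0 < r i"
  obtains V where "V \<subseteq> I" "disjoint_family_on (\<lambda>i. ball (c i) (r i)) V"
    "\<forall>i\<in>I. \<exists>j\<in>V. dist (c i) (c j) \<le> r i + r j \<and> r i \<le> 5 * r j \<and> ball (c i) (r i) \<subseteq> ball (c j) (5 * r j)"
proof -
  have *: "0 < r i \<and> r i \<le> Max (r ` I)" if "i \<in> I" for i
    using r[OF that] I that by auto
  obtain V where V: "V \<subseteq> I" "pairwise (\<lambda>i j. disjnt (cball (c i) (r i)) (cball (c j) (r j))) V"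
    "\<And>i. i \<in> I \<Longrightarrow> \<exists>j. j \<in> V \<and> \<not> disjnt (cball (c i) (r i)) (cball (c j) (r j)) \<and>
        cball (c i) (r i) \<subseteq> ball (c j) (5 * r j)"
    by (rule Vitali_covering_lemma_cballs_balls[where K = I and a = c and r = r, OF *]) auto
  show thesis
  proof
    show "V \<subseteq> I" by fact
    have "ball (c i) (r i) \<inter> ball (c j) (r j) = {}" if "i \<in> V" "j \<in> V" "i \<noteq> j" for i j
      using pairwiseD[OF V(2) that] ball_subset_cball[of "c i" "r i"] ball_subset_cball[of "c j" "r j"]
      unfolding disjnt_def by blast
    then show "disjoint_family_on (\<lambda>i. ball (c i) (r i)) V"
      unfolding disjoint_family_on_def by auto
    show "\<forall>i\<in>I. \<exists>j\<in>V. dist (c i) (c j) \<le> r i + r j \<and> r i \<le> 5 * r j \<and> ball (c i) (r i) \<subseteq> ball (c j) (5 * r j)"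
    proof
      fix i assume i: "i \<in> I"
      then obtain j where j: "j \<in> V" "\<not> disjnt (cball (c i) (r i)) (cball (c j) (r j))"
          "cball (c i) (r i) \<subseteq> ball (c j) (5 * r j)"
        using V(3) by blast
      then obtain y where "dist (c i) y \<le> r i" "dist (c j) y \<le> r j"
        by (auto simp: disjnt_def)
      then have "dist (c i) (c j) \<le> r i + r j"
        using dist_triangle2[of "c i" "c j" y] by linarith
      moreover have sub: "ball (c i) (r i) \<subseteq> ball (c j) (5 * r j)"
        using j(3) ball_subset_cball by blast
      then have "r i \<le> 5 * r j"
        using r[OF i] zero_le_dist[of "c i" "c j"] unfolding ball_subset_ball_iff by linarith
      ultimately show "\<exists>j\<in>V. dist (c i) (c j) \<le> r i + r j \<and> r i \<le> 5 * r j \<and> ball (c i) (r i) \<subseteq> ball (c j) (5 * r j)"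
        using j(1) sub by blast
    qed
  qed
qed

lemma power_diff_le:
  fixes a b :: real
  assumes "0 \<le> b" "b \<le> a"
  shows "a ^ n - b ^ n \<le> real n * (a - b) * a ^ (n - 1)"
proof (induction n)
  case (Suc n)
  have "a * a ^ (n - 1) = a ^ n" if "n \<noteq> 0"
    using that by (cases n) auto
  then have *: "real n * (a - b) * (a * a ^ (n - 1)) = real n * (a - b) * a ^ n"
    by (cases "n = 0") auto
  have "a ^ Suc n - b ^ Suc n = a * (a ^ n - b ^ n) + (a - b) * b ^ n"
    by (simp add: algebra_simps)
  also have "\<dots> \<le> a * (real n * (a - b) * a ^ (n - 1)) + (a - b) * a ^ n"
    using assms Suc by (intro add_mono mult_left_mono power_mono) auto
  also have "a * (real n * (a - b) * a ^ (n - 1)) = real n * (a - b) * a ^ n"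
    using * by (simp only: ac_simps)
  finally show ?case by (simp add: algebra_simps)
qed simp

text \<open>The inner radius may be negative, so the proof truncates it at 0; the outer radius is at
  most \<open>21 * r\<close>. The bound \<open>w \<le> 20 * r\<close> fits widths
  \<open>4 * 2 powr k\<close> with \<open>2 powr k \<le> 5 * r\<close>.\<close>

lemma vol_annulus_le:
  fixes c :: "'a::euclidean_space"
  assumes "0 < r" "0 \<le> w" "w \<le> 20 * r"
  shows "vol (ball c (r + w) - ball c (r - w)) \<le> ball_vol TYPE('a) * (2 * real DIM('a) * 21 ^ (DIM('a) - 1)) * w * r ^ (DIM('a) - 1)"
proof -
  define n where "n = DIM('a)"
  define v where "v = max (r - w) 0"
  have v: "0 \<le> v" "v \<le> r + w" "r + w - v \<le> 2 * w"
    using assms by (auto simp: v_def)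
  have "ball c (r - w) = ball c v"
    by (auto simp: v_def max_def)
  moreover have "ball c v \<subseteq> ball c (r + w)"
    using v by (intro subset_ball)
  ultimately have "vol (ball c (r + w) - ball c (r - w)) = vol (ball c (r + w)) - vol (ball c v)"
    by (simp only: measurable_measure_Diff lmeasurable_ball fmeasurableD)
  also have "\<dots> = ball_vol TYPE('a) * ((r + w) ^ n - v ^ n)"
    using v unfolding n_def by (simp only: vol_ball[of v] vol_ball[OF order.trans[OF v(1,2)]] right_diff_distrib)
  also have "\<dots> \<le> ball_vol TYPE('a) * (real n * (2 * w) * (21 * r) ^ (n - 1))"
  proof (rule mult_left_mono)
    have "(r + w) ^ n - v ^ n \<le> real n * (r + w - v) * (r + w) ^ (n - 1)"
      using v by (intro power_diff_le)
    also have "\<dots> \<le> real n * (2 * w) * (21 * r) ^ (n - 1)"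
      using v assms by (intro mult_mono power_mono mult_left_mono) auto
    finally show "(r + w) ^ n - v ^ n \<le> real n * (2 * w) * (21 * r) ^ (n - 1)" .
  qed simp
  also have "\<dots> = ball_vol TYPE('a) * (2 * real n * 21 ^ (n - 1)) * w * r ^ (n - 1)"
    by (simp add: power_mult_distrib)
  finally show ?thesis unfolding n_def .
qed

text \<open>The exponents are distinct integers: those below the largest exponent \<open>b\<close>
  are at most \<open>b - 1\<close>, so by induction they contribute at most \<open>2 powr b\<close>,
  and the whole sum is at most twice its largest term.\<close>

lemma sum_powers_two_le:
  fixes K :: "int set"
  assumes "finite K" "\<And>k. k \<in> K \<Longrightarrow> 2 powr k \<le> M" "0 \<le> M"
  shows "(\<Sum>k\<in>K. 2 powr k) \<le> 2 * (M::real)"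
  using assms
proof (induction K arbitrary: M rule: finite_linorder_max_induct)
  case (insert b A)
  have "(\<Sum>k\<in>A. 2 powr k) \<le> 2 * 2 powr (b - 1)"
    using insert(2) by (intro insert.IH) auto
  also have "\<dots> = 2 powr b"
    by (simp add: powr_diff)
  finally have "(\<Sum>k\<in>A. 2 powr k) \<le> (2::real) powr b" .
  moreover have "2 powr b \<le> M" using insert by auto
  moreover have "b \<notin> A" using insert(2) by auto
  ultimately show ?case
    using insert(1) by simp
qed simp

text \<open>The summands account for the shell of shallow points, for the Vitali balls, and for all
  dyadic scales together; the last is the single-scale factor \<open>2 * 24 ^ n\<close> times the
  constant from summing the annuli.\<close>

definition thin_part_const :: "nat \<Rightarrow> real" where
  "thin_part_const n = real n + 1 + 2 * 24 ^ n * (80 * real n * 21 ^ (n - 1))"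

text \<open>
  Points at relative depth less than \<open>s\<^sup>2\<close> in every ball are controlled by the contraction bound. The
  remaining points outside a Vitali subfamily \<open>V\<close> are treated one dyadic scale \<open>2\<^sup>k\<close> at a time: the
  balls of that scale which leave \<open>V\<close> stay within annuli of width about \<open>2\<^sup>k\<close> around the
  larger members of \<open>V\<close>, and the volumes of these annuli sum to a multiple of the volume of \<open>V\<close>.
\<close>
lemma vol_thin_part_le:
  fixes c :: "'i \<Rightarrow> 'a::euclidean_space"
  assumes I: "finite I" and r: "\<And>i. i \<in> I \<Longrightarrow> 0 < r i" and s: "0 < s" "s < 1" and D: "D \<in> sets lebesgue"
    and thin: "\<And>i. i \<in> I \<Longrightarrow> vol (D \<inter> ball (c i) (r i)) \<le> s ^ (DIM('a) + 1) * vol (ball (c i) (r i))"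
  shows "vol (D \<inter> (\<Union>i\<in>I. ball (c i) (r i)))
    \<le> thin_part_const DIM('a) * s\<^sup>2 * vol (\<Union>i\<in>I. ball (c i) (r i))"
proof -
  define n where "n = DIM('a)"
  have n: "n \<ge> 1" by (simp add: n_def)
  define \<omega> where "\<omega> = ball_vol TYPE('a)"
  have \<omega>: "0 < \<omega>" unfolding \<omega>_def by simp
  define H where "H = (\<Union>i\<in>I. ball (c i) (r i))"
  define H' where "H' = (\<Union>i\<in>I. ball (c i) ((1 - s\<^sup>2) * r i))"
  have s2: "0 < 1 - s\<^sup>2" "1 - s\<^sup>2 \<le> 1" "0 < s\<^sup>2"
    using s by (simp_all add: power_less_one_iff abs_square_less_1)
  have Hm: "H \<in> lmeasurable" "H' \<in> lmeasurable"
    unfolding H_def H'_def using I by (auto intro!: fmeasurable.finite_UN)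
  have "H' \<subseteq> H"
    unfolding H_def H'_def using s2 r
    by (intro UN_mono subset_ball) (auto intro: mult_left_le_one_le less_imp_le)
  obtain V where V: "V \<subseteq> I" "disjoint_family_on (\<lambda>i. ball (c i) (r i)) V"
    "\<forall>i\<in>I. \<exists>j\<in>V. dist (c i) (c j) \<le> r i + r j \<and> r i \<le> 5 * r j \<and> ball (c i) (r i) \<subseteq> ball (c j) (5 * r j)"
    by (rule Vitali_finite_balls[where c = c and r = r, OF I r])
  define W where "W = (\<Union>j\<in>V. ball (c j) (r j))"
  have finV: "finite V" using V(1) I finite_subset by auto
  have Wm: "W \<in> lmeasurable"
    unfolding W_def using finV by (auto intro!: fmeasurable.finite_UN)
  have volW: "(\<Sum>j\<in>V. vol (ball (c j) (r j))) = vol W"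
    unfolding W_def using finV V(2)
    by (intro measure_UNION'[symmetric]) (auto simp: pairwise_def disjnt_def disjoint_family_on_def)
  have "vol W \<le> vol H"
    using Wm Hm by (intro measure_mono_fmeasurable) (use V(1) in \<open>auto simp: W_def H_def\<close>)
  have volWr: "\<omega> * (\<Sum>j\<in>V. r j ^ n) = vol W"
    unfolding volW[symmetric] sum_distrib_left \<omega>_def n_def
    using V(1) r by (intro sum.cong refl vol_ball[symmetric] less_imp_le) auto

  \<comment> \<open>The contraction bound with factor \<open>1 - s\<^sup>2\<close>, combined with
    Bernoulli's inequality.\<close>
  have shell: "vol (H - H') \<le> real n * s\<^sup>2 * vol H"
  proof -
    have "(1 - s\<^sup>2) ^ n * vol H \<le> vol H'"
      unfolding n_def H_def H'_def using s2 by (intro vol_Union_shrunk_balls I r) auto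
    moreover have "1 - (1 - s\<^sup>2) ^ n \<le> real n * s\<^sup>2"
      using power_diff_le[of "1 - s\<^sup>2" 1 n] s2 by simp
    then have "(1 - (1 - s\<^sup>2) ^ n) * vol H \<le> real n * s\<^sup>2 * vol H"
      by (intro mult_right_mono) auto
    moreover have "vol (H - H') = vol H - vol H'"
      using Hm \<open>H' \<subseteq> H\<close> by (intro measurable_measure_Diff) auto
    ultimately show ?thesis
      by (simp add: algebra_simps)
  qed

  \<comment> \<open>On the disjoint balls of \<open>V\<close> the density hypothesis can simply be
    summed.\<close>
  have core: "vol (D \<inter> W) \<le> s\<^sup>2 * vol H"
  proof -
    have "vol (D \<inter> W) = vol (\<Union>j\<in>V. D \<inter> ball (c j) (r j))"
      unfolding W_def by (intro arg_cong[where f = vol]) auto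
    also have "\<dots> \<le> (\<Sum>j\<in>V. vol (D \<inter> ball (c j) (r j)))"
      using finV D by (intro measure_UNION_le) auto
    also have "\<dots> \<le> (\<Sum>j\<in>V. s ^ (n + 1) * vol (ball (c j) (r j)))"
      unfolding n_def using V(1) by (intro sum_mono thin) auto
    also have "\<dots> = s ^ (n + 1) * vol W"
      unfolding volW[symmetric] by (rule sum_distrib_left[symmetric])
    also have "\<dots> \<le> s\<^sup>2 * vol H"
      using s n \<open>vol W \<le> vol H\<close> by (intro mult_mono power_decreasing) auto
    finally show ?thesis .
  qed

  define sc where "sc i = \<lfloor>log 2 (r i)\<rfloor>" for i
  have sc: "2 powr sc i \<le> r i" "r i \<le> 2 * 2 powr sc i" if "i \<in> I" for i
  proof -
    have "real_of_int (sc i) \<le> log 2 (r i)" "log 2 (r i) \<le> 1 + real_of_int (sc i)"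
      unfolding sc_def by linarith+
    then have "2 powr sc i \<le> 2 powr log 2 (r i)" "2 powr log 2 (r i) \<le> 2 powr (1 + real_of_int (sc i))"
      by (intro powr_mono; simp)+
    then show "2 powr sc i \<le> r i" "r i \<le> 2 * 2 powr sc i"
      using r[OF that] by (simp_all add: powr_add)
  qed
  define K where "K = sc ` I"
  \<comment> \<open>The half-width \<open>4 * 2 powr k\<close> bounds the diameter of every ball of
    scale \<open>k\<close>.\<close>
  define Ann where "Ann k j = ball (c j) (r j + 4 * 2 powr k) - ball (c j) (r j - 4 * 2 powr k)" for k :: int and j
  \<comment> \<open>The restriction on \<open>j\<close> holds for the selected ball paired with any
    ball of scale \<open>k\<close>, and it makes the sum over \<open>k\<close> for fixed
    \<open>j\<close> geometric.\<close>
  define Z where "Z k = (\<Union>j\<in>{j\<in>V. 2 powr k \<le> 5 * r j}. Ann k j)" for k :: int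
  define A where "A k = (\<Union>i\<in>{i\<in>I. sc i = k}. ball (c i) ((1 - s\<^sup>2) * r i)) - W" for k
  have Annm: "Ann k j \<in> lmeasurable" for k j
    unfolding Ann_def by (intro fmeasurable.Diff) auto
  have Zm: "Z k \<in> lmeasurable" for k
    unfolding Z_def using finV Annm by (intro fmeasurable.finite_UN) auto
  have Am: "A k \<in> sets lebesgue" for k
    unfolding A_def using I Wm by (intro sets.Diff sets.finite_UN) auto
  define C where "C = \<omega> * (2 * real n * 21 ^ (n - 1))"
  have C: "0 \<le> C" unfolding C_def using \<omega> by simp
  have Ann_le: "vol (Ann k j) \<le> C * (4 * 2 powr k) * r j ^ (n - 1)" if "j \<in> V" "2 powr k \<le> 5 * r j" for k j
    unfolding Ann_def C_def \<omega>_def n_def using that V(1) r by (intro vol_annulus_le) auto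
  have sumZ: "(\<Sum>k\<in>K. vol (Z k)) \<le> 80 * real n * 21 ^ (n - 1) * vol W"
  proof -
    have "(\<Sum>k\<in>K. vol (Z k)) \<le> (\<Sum>k\<in>K. \<Sum>j\<in>{j\<in>V. 2 powr k \<le> 5 * r j}. vol (Ann k j))"
      unfolding Z_def using finV Annm by (intro sum_mono measure_UNION_le) auto
    also have "\<dots> \<le> (\<Sum>k\<in>K. \<Sum>j\<in>{j\<in>V. 2 powr k \<le> 5 * r j}. C * (4 * 2 powr k) * r j ^ (n - 1))"
      by (intro sum_mono Ann_le) auto
    \<comment> \<open>After the exchange the annuli around one ball are summed first; their widths
      add up to a multiple of \<open>r j\<close>, and their volumes to a multiple of
      \<open>r j ^ n\<close>.\<close>
    also have "\<dots> = (\<Sum>j\<in>V. \<Sum>k\<in>{k\<in>K. 2 powr k \<le> 5 * r j}. C * (4 * 2 powr k) * r j ^ (n - 1))"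
      using finV I unfolding K_def by (intro sum.swap_restrict) auto
    also have "\<dots> = (\<Sum>j\<in>V. 4 * C * r j ^ (n - 1) * (\<Sum>k\<in>{k\<in>K. 2 powr k \<le> 5 * r j}. 2 powr k))"
      unfolding sum_distrib_left by (intro sum.cong refl) simp
    also have "\<dots> \<le> (\<Sum>j\<in>V. 4 * C * r j ^ (n - 1) * (2 * (5 * r j)))"
      using I V(1) r C unfolding K_def
      by (intro sum_mono mult_left_mono sum_powers_two_le) (auto intro!: less_imp_le[OF r] mult_nonneg_nonneg zero_le_power)
    also have "\<dots> = (\<Sum>j\<in>V. 40 * C * r j ^ n)"
      using n by (intro sum.cong refl) (simp add: power_eq_if)
    also have "\<dots> = 80 * real n * 21 ^ (n - 1) * vol W"
      unfolding volWr[symmetric] C_def sum_distrib_left by (intro sum.cong refl) simp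
    finally show ?thesis .
  qed
  have scale: "vol (D \<inter> A k) \<le> 2 * 24 ^ n * s\<^sup>2 * vol (Z k)" for k
  proof -
    have "s ^ (DIM('a) - 1) * vol (D \<inter> A k) \<le> s ^ (DIM('a) + 1) * (2 * 24 ^ DIM('a)) * vol (Z k)"
    proof (rule single_scale_estimate[where I = "{i\<in>I. sc i = k}" and R = "2 powr k" and c = c and r = r])
      fix x assume "x \<in> A k"
      then obtain i where i: "i \<in> I" "sc i = k" "dist x (c i) < (1 - s\<^sup>2) * r i" "x \<notin> W"
        unfolding A_def by (auto simp: dist_commute)
      have "(1 - s\<^sup>2) * r i \<le> r i"
        using s2 r[OF i(1)] by (intro mult_left_le_one_le) auto
      then have xi: "dist x (c i) < r i" using i(3) by linarith
      obtain j where j: "j \<in> V" "dist (c i) (c j) \<le> r i + r j" "r i \<le> 5 * r j"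
        using V(3) i(1) by blast
      have rk: "2 powr k \<le> r i" "r i \<le> 2 * 2 powr k"
        using sc[OF i(1)] i(2) by auto
      have xj: "r j \<le> dist x (c j)"
        using i(4) j(1) unfolding W_def by (auto simp: dist_commute not_less)
      \<comment> \<open>The outer radius comes from the distance of the centres of the two meeting
        balls, the inner one from the fact that \<open>x\<close> lies outside \<open>W\<close> and
        hence outside ball \<open>j\<close>.\<close>
      have "{z. dist x z + dist z (c i) < r i} \<subseteq> Ann k j"
      proof
        fix z assume "z \<in> {z. dist x z + dist z (c i) < r i}"
        then have z: "dist x z + dist z (c i) < r i" by simp
        have "dist z (c j) < r j + 4 * 2 powr k"
          using dist_triangle[of z "c j" "c i"] z j(2) rk zero_le_dist[of x z] by linarith
        moreover have "dist z (c j) \<ge> r j - 4 * 2 powr k"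
          using dist_triangle[of x "c j" z] z xj rk zero_le_dist[of z "c i"] by linarith
        ultimately show "z \<in> Ann k j"
          unfolding Ann_def by (simp add: dist_commute not_less)
      qed
      also have "Ann k j \<subseteq> Z k"
        unfolding Z_def using j rk by (intro UN_upper) auto
      finally show "\<exists>i\<in>{i \<in> I. sc i = k}. dist x (c i) \<le> (1 - s\<^sup>2) * r i \<and> {z. dist x z + dist z (c i) < r i} \<subseteq> Z k"
        using i by (intro bexI[of _ i]) auto
    qed (use I s sc D Am Zm thin in auto)
    also have "s ^ (DIM('a) + 1) = s ^ (n - 1) * s\<^sup>2"
      using n unfolding n_def by (simp flip: power_add)
    finally have "s ^ (n - 1) * vol (D \<inter> A k) \<le> s ^ (n - 1) * (2 * 24 ^ n * s\<^sup>2 * vol (Z k))"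
      unfolding n_def by (simp only: ac_simps)
    then show ?thesis
      by (rule mult_left_le_imp_le) (use s in simp)
  qed
  \<comment> \<open>A point of \<open>H\<close> is shallow in every ball, or lies in a selected
    ball, or is outside \<open>W\<close> and deep in a ball of some scale.\<close>
  have "D \<inter> H \<subseteq> (H - H') \<union> (D \<inter> W) \<union> (\<Union>k\<in>K. D \<inter> A k)"
    unfolding H'_def K_def A_def by auto
  moreover have DAm: "D \<inter> A k \<in> lmeasurable" for k
    using D Am by (intro fmeasurableI2[OF Hm(2)]) (auto simp: A_def H'_def)
  moreover have DWm: "D \<inter> W \<in> lmeasurable"
    using D Wm by (intro fmeasurableI2[OF Wm]) auto
  ultimately have "vol (D \<inter> H) \<le> vol ((H - H') \<union> (D \<inter> W) \<union> (\<Union>k\<in>K. D \<inter> A k))"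
    using D Hm I unfolding K_def
    by (intro measure_mono_fmeasurable fmeasurable.Un fmeasurable.finite_UN fmeasurable.Diff) auto
  also have "\<dots> \<le> vol (H - H') + vol (D \<inter> W) + vol (\<Union>k\<in>K. D \<inter> A k)"
    using D Hm Wm Am I unfolding K_def
    by (intro order.trans[OF measure_Un_le] add_mono measure_Un_le order.refl sets.Un sets.finite_UN) auto
  also have "vol (\<Union>k\<in>K. D \<inter> A k) \<le> (\<Sum>k\<in>K. vol (D \<inter> A k))"
    using D Am I unfolding K_def by (intro measure_UNION_le) auto
  also have "\<dots> \<le> (\<Sum>k\<in>K. 2 * 24 ^ n * s\<^sup>2 * vol (Z k))"
    by (intro sum_mono scale)
  also have "\<dots> = 2 * 24 ^ n * s\<^sup>2 * (\<Sum>k\<in>K. vol (Z k))"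
    by (simp add: sum_distrib_left)
  also have "\<dots> \<le> 2 * 24 ^ n * s\<^sup>2 * (80 * real n * 21 ^ (n - 1) * vol H)"
    using sumZ \<open>vol W \<le> vol H\<close> by (intro mult_left_mono order.trans[OF sumZ]) auto
  finally have "vol (D \<inter> H) \<le> real n * s\<^sup>2 * vol H + s\<^sup>2 * vol H
      + 2 * 24 ^ n * s\<^sup>2 * (80 * real n * 21 ^ (n - 1) * vol H)"
    using shell core by linarith
  also have "\<dots> = thin_part_const n * s\<^sup>2 * vol H"
    unfolding thin_part_const_def by (simp add: algebra_simps)
  finally show ?thesis
    unfolding n_def H_def .
qed

section \<open>Halo sets and the Tauberian constant\<close>

text \<open>For measurable \<open>E\<close> and positive \<alpha> this is the superlevel set of the
  maximal function of the indicator of \<open>E\<close>, written without division or extended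
  reals.\<close>

definition halo_set :: "'a::euclidean_space set \<Rightarrow> real \<Rightarrow> 'a set" where
  "halo_set E \<alpha> = \<Union> {ball c r | c r. 0 < r \<and> \<alpha> * vol (ball c r) < vol (E \<inter> ball c r)}"

lemma open_halo_set: "open (halo_set E \<alpha>)"
  unfolding halo_set_def by (intro open_Union) auto

lemma vol_Int_ball:
  assumes "E \<in> sets lebesgue"
  shows "E \<inter> ball c r \<in> lmeasurable" "ball c r \<inter> E \<in> lmeasurable"
  using assms by (auto intro!: fmeasurableI2[OF lmeasurable_ball, of _ c r])

lemma superlevel_set_eq_halo_set:
  fixes E :: "(real ^ 'n) set"
  assumes E: "E \<in> sets lebesgue" and \<alpha>: "0 < \<alpha>"
  shows "{x. maximal_function (indicat_real E) x > ennreal \<alpha>} = halo_set E \<alpha>"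
proof -
  have avg: "ennreal \<alpha> < (\<integral>\<^sup>+ y \<in> ball c r. ennreal \<bar>indicat_real E y\<bar> \<partial>lebesgue) / emeasure lebesgue (ball c r)
      \<longleftrightarrow> \<alpha> * vol (ball c r) < vol (E \<inter> ball c r)" if "0 < r" for c :: "real ^ 'n" and r
  proof -
    have pos: "0 < vol (ball c r)"
      using that by simp
    have "(\<integral>\<^sup>+ y \<in> ball c r. ennreal \<bar>indicat_real E y\<bar> \<partial>lebesgue) = (\<integral>\<^sup>+ y. indicator (E \<inter> ball c r) y \<partial>lebesgue)"
      by (intro nn_integral_cong) (auto simp: indicator_def)
    also have "\<dots> = ennreal (vol (E \<inter> ball c r))"
      using vol_Int_ball[OF E] E by (simp add: emeasure_eq_measure2 sets.Int)
    finally have 1: "(\<integral>\<^sup>+ y \<in> ball c r. ennreal \<bar>indicat_real E y\<bar> \<partial>lebesgue) = ennreal (vol (E \<inter> ball c r))" .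
    have 2: "emeasure lebesgue (ball c r) = ennreal (vol (ball c r))"
      by (rule emeasure_eq_measure2) simp
    have 3: "ennreal (vol (E \<inter> ball c r)) / ennreal (vol (ball c r)) = ennreal (vol (E \<inter> ball c r) / vol (ball c r))"
      using pos by (intro divide_ennreal) auto
    show ?thesis
      unfolding 1 2 3 using \<alpha> pos by (simp only: ennreal_less_iff pos_less_divide_eq less_imp_le)
  qed
  show ?thesis
  proof (rule set_eqI)
    fix x :: "real ^ 'n"
    have "x \<in> {x. maximal_function (indicat_real E) x > ennreal \<alpha>} \<longleftrightarrow>
      (\<exists>c r. 0 < r \<and> x \<in> ball c r \<and>
        ennreal \<alpha> < (\<integral>\<^sup>+ y \<in> ball c r. ennreal \<bar>indicat_real E y\<bar> \<partial>lebesgue) / emeasure lebesgue (ball c r))"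
      unfolding maximal_function_def mem_Collect_eq less_SUP_iff Bex_def by blast
    also have "\<dots> \<longleftrightarrow> x \<in> halo_set E \<alpha>"
      unfolding halo_set_def using avg by blast
    finally show "x \<in> {x. maximal_function (indicat_real E) x > ennreal \<alpha>} \<longleftrightarrow> x \<in> halo_set E \<alpha>" .
  qed
qed

text \<open>By Lindelof countably many of the dense balls have the same union, and continuity from
  below carries a bound uniform over finite subfamilies to that union. Membership in
  \<open>lmeasurable\<close> is part of the conclusion because \<open>measure\<close> is 0 on sets
  of infinite measure.\<close>

lemma vol_halo_set_leI:
  fixes E :: "'a::euclidean_space set"
  assumes "\<And>I :: ('a \<times> real) set. finite I \<Longrightarrow>
      (\<And>i. i \<in> I \<Longrightarrow> 0 < snd i) \<Longrightarrow>
      (\<And>i. i \<in> I \<Longrightarrow> \<alpha> * vol (ball (fst i) (snd i)) < vol (E \<inter> ball (fst i) (snd i))) \<Longrightarrow>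
      vol (\<Union>i\<in>I. ball (fst i) (snd i)) \<le> M"
  shows "halo_set E \<alpha> \<in> lmeasurable" "vol (halo_set E \<alpha>) \<le> M"
proof -
  define \<F> where "\<F> = {ball c r | c r. 0 < r \<and> \<alpha> * vol (ball c r) < vol (E \<inter> ball c r)}"
  obtain \<G> where \<G>: "\<G> \<subseteq> \<F>" "countable \<G>" "\<Union>\<G> = \<Union>\<F>"
    by (rule Lindelof[of \<F>]) (auto simp: \<F>_def)
  have eq: "halo_set E \<alpha> = (\<Union>B\<in>\<G>. B)"
    unfolding halo_set_def \<F>_def[symmetric] using \<G>(3) by simp
  have B: "B \<in> lmeasurable" if "B \<in> \<G>" for B
    using that \<G>(1) by (auto simp: \<F>_def)
  have fin: "vol (\<Union>B\<in>\<G>'. B) \<le> M" if \<G>': "\<G>' \<subseteq> \<G>" "finite \<G>'" for \<G>'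
  proof -
    have "\<forall>B\<in>\<G>'. \<exists>i. B = ball (fst i) (snd i) \<and> 0 < snd i \<and>
        \<alpha> * vol (ball (fst i) (snd i)) < vol (E \<inter> ball (fst i) (snd i))"
    proof
      fix B assume "B \<in> \<G>'"
      then obtain c r where "B = ball c r" "0 < r" "\<alpha> * vol (ball c r) < vol (E \<inter> ball c r)"
        using \<G>' \<G>(1) unfolding \<F>_def by blast
      then show "\<exists>i. B = ball (fst i) (snd i) \<and> 0 < snd i \<and>
          \<alpha> * vol (ball (fst i) (snd i)) < vol (E \<inter> ball (fst i) (snd i))"
        by (intro exI[of _ "(c, r)"]) auto
    qed
    then obtain g where g: "\<And>B. B \<in> \<G>' \<Longrightarrow> B = ball (fst (g B)) (snd (g B)) \<and> 0 < snd (g B) \<and>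
        \<alpha> * vol (ball (fst (g B)) (snd (g B))) < vol (E \<inter> ball (fst (g B)) (snd (g B)))"
      by metis
    have "(\<Union>B\<in>\<G>'. B) = (\<Union>i\<in>g ` \<G>'. ball (fst i) (snd i))"
      using g by auto
    also have "vol \<dots> \<le> M"
    proof (rule assms)
      show "finite (g ` \<G>')" using \<G>'(2) by simp
      show "0 < snd i" if "i \<in> g ` \<G>'" for i
        using that g by blast
      show "\<alpha> * vol (ball (fst i) (snd i)) < vol (E \<inter> ball (fst i) (snd i))" if "i \<in> g ` \<G>'" for i
        using that g by blast
    qed
    finally show ?thesis .
  qed
  show "halo_set E \<alpha> \<in> lmeasurable"
    unfolding eq by (rule fmeasurable_UN_bound[OF \<G>(2) B fin])
  show "vol (halo_set E \<alpha>) \<le> M"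
    unfolding eq by (rule measure_UN_bound[OF \<G>(2) B fin])
qed

text \<open>The classical weak type argument: disjoint selected balls, dilated by 5, cover the
  union, and each carries its own portion of \<open>E\<close>.\<close>

lemma vol_Union_dense_balls_le:
  fixes E :: "'a::euclidean_space set" and c :: "'i \<Rightarrow> 'a"
  assumes E: "E \<in> lmeasurable" and \<alpha>: "0 < \<alpha>" and I: "finite I" and r: "\<And>i. i \<in> I \<Longrightarrow> 0 < r i"
    and dense: "\<And>i. i \<in> I \<Longrightarrow> \<alpha> * vol (ball (c i) (r i)) < vol (E \<inter> ball (c i) (r i))"
  shows "vol (\<Union>i\<in>I. ball (c i) (r i)) \<le> 5 ^ DIM('a) / \<alpha> * vol E"
proof -
  obtain V where V: "V \<subseteq> I" "disjoint_family_on (\<lambda>i. ball (c i) (r i)) V"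
    "\<forall>i\<in>I. \<exists>j\<in>V. dist (c i) (c j) \<le> r i + r j \<and> r i \<le> 5 * r j \<and> ball (c i) (r i) \<subseteq> ball (c j) (5 * r j)"
    by (rule Vitali_finite_balls[where c = c and r = r, OF I r])
  have finV: "finite V" using V(1) I finite_subset by auto
  have "vol (\<Union>i\<in>I. ball (c i) (r i)) \<le> vol (\<Union>j\<in>V. ball (c j) (5 * r j))"
    using V(3) I finV by (intro measure_mono_fmeasurable fmeasurable.finite_UN) (fastforce intro!: sets.finite_UN)+
  also have "\<dots> \<le> (\<Sum>j\<in>V. vol (ball (c j) (5 * r j)))"
    using finV by (intro measure_UNION_le) auto
  also have "\<dots> \<le> (\<Sum>j\<in>V. 5 ^ DIM('a) / \<alpha> * vol (E \<inter> ball (c j) (r j)))"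
  proof (rule sum_mono)
    fix j assume "j \<in> V"
    then have j: "j \<in> I" using V(1) by auto
    have "vol (ball (c j) (5 * r j)) = 5 ^ DIM('a) * vol (ball (c j) (r j))"
      using r[OF j] by (simp only: vol_ball less_imp_le mult_nonneg_nonneg zero_le_numeral power_mult_distrib mult.left_commute)
    also have "\<dots> \<le> 5 ^ DIM('a) * (vol (E \<inter> ball (c j) (r j)) / \<alpha>)"
      using dense[OF j] \<alpha> by (intro mult_left_mono) (simp_all only: pos_le_divide_eq mult.commute less_imp_le zero_le_numeral zero_le_power)
    finally show "vol (ball (c j) (5 * r j)) \<le> 5 ^ DIM('a) / \<alpha> * vol (E \<inter> ball (c j) (r j))"
      by simp
  qed
  also have "\<dots> = 5 ^ DIM('a) / \<alpha> * (\<Sum>j\<in>V. vol (E \<inter> ball (c j) (r j)))"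
    by (rule sum_distrib_left[symmetric])
  also have "(\<Sum>j\<in>V. vol (E \<inter> ball (c j) (r j))) = vol (\<Union>j\<in>V. E \<inter> ball (c j) (r j))"
    using finV V(2) E by (intro measure_UNION'[symmetric] vol_Int_ball)
      (auto simp: pairwise_def disjnt_def disjoint_family_on_def)
  also have "5 ^ DIM('a) / \<alpha> * vol (\<Union>j\<in>V. E \<inter> ball (c j) (r j)) \<le> 5 ^ DIM('a) / \<alpha> * vol E"
    using E finV \<alpha> by (intro mult_left_mono measure_mono_fmeasurable sets.finite_UN) auto
  finally show ?thesis .
qed

lemma vol_halo_set_weak_type:
  fixes E :: "'a::euclidean_space set"
  assumes "E \<in> lmeasurable" "0 < \<alpha>"
  shows "halo_set E \<alpha> \<in> lmeasurable" "vol (halo_set E \<alpha>) \<le> 5 ^ DIM('a) / \<alpha> * vol E"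
  using vol_halo_set_leI[where E = E and \<alpha> = \<alpha>, OF vol_Union_dense_balls_le[OF assms]] by blast+

text \<open>In every ball that enters, the complement of \<open>E\<close> has density below
  \<open>s ^ (n + 1)\<close> with \<open>n = DIM('a)\<close>, so the thin part estimate bounds what
  a finite union adds to \<open>E\<close>. The added volume is a multiple \<open>k\<close> of the
  union's own volume; absorbing it costs \<open>1 / (1 - k)\<close>, which is at most
  \<open>1 + 2 * k\<close> for \<open>k \<le> 1 / 2\<close>.\<close>

lemma vol_halo_set_Solyanik:
  fixes E :: "'a::euclidean_space set"
  assumes E: "E \<in> lmeasurable" and s: "0 < s" "s < 1" and small: "thin_part_const DIM('a) * s\<^sup>2 \<le> 1 / 2"
  shows "vol (halo_set E (1 - s ^ (DIM('a) + 1))) \<le> (1 + 2 * thin_part_const DIM('a) * s\<^sup>2) * vol E"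
proof (rule vol_halo_set_leI)
  fix I :: "('a \<times> real) set"
  let ?B = "\<lambda>i :: 'a \<times> real. ball (fst i) (snd i)"
  let ?H = "\<Union>i\<in>I. ?B i" and ?k = "thin_part_const DIM('a) * s\<^sup>2"
  assume I: "finite I" and r: "\<And>i. i \<in> I \<Longrightarrow> 0 < snd i"
    and dense: "\<And>i. i \<in> I \<Longrightarrow> (1 - s ^ (DIM('a) + 1)) * vol (?B i) < vol (E \<inter> ?B i)"
  have Hm: "?H \<in> lmeasurable"
    using I by (intro fmeasurable.finite_UN) auto
  have "vol ((UNIV - E) \<inter> ?H) \<le> ?k * vol ?H"
  proof (rule vol_thin_part_le[OF I r s])
    fix i assume i: "i \<in> I"
    have "vol ((UNIV - E) \<inter> ?B i) = vol (?B i - E \<inter> ?B i)"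
      by (intro arg_cong[where f = vol]) auto
    also have "\<dots> = vol (?B i) - vol (E \<inter> ?B i)"
      using vol_Int_ball E by (intro measurable_measure_Diff) auto
    also have "\<dots> \<le> s ^ (DIM('a) + 1) * vol (?B i)"
      using dense[OF i] unfolding left_diff_distrib by linarith
    finally show "vol ((UNIV - E) \<inter> ?B i) \<le> s ^ (DIM('a) + 1) * vol (?B i)" .
  qed (use E in auto)
  moreover have "vol ?H \<le> vol (E \<union> ((UNIV - E) \<inter> ?H))"
    using E Hm by (intro measure_mono_fmeasurable fmeasurable.Un fmeasurableI2[OF Hm, of "(UNIV - E) \<inter> ?H"]) auto
  moreover have "\<dots> \<le> vol E + vol ((UNIV - E) \<inter> ?H)"
    using E Hm by (intro measure_Un_le) auto
  ultimately have le: "(1 - ?k) * vol ?H \<le> vol E"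
    unfolding left_diff_distrib by linarith
  have k: "0 \<le> ?k" unfolding thin_part_const_def by simp
  have "vol ?H \<le> (1 + 2 * ?k) * ((1 - ?k) * vol ?H)"
  proof -
    have "0 \<le> 1 - 2 * ?k"
      using small by linarith
    then have "0 \<le> ?k * (1 - 2 * ?k) * vol ?H"
      by (rule mult_nonneg_nonneg[OF mult_nonneg_nonneg[OF k] measure_nonneg])
    then show ?thesis by (simp add: algebra_simps)
  qed
  also have "\<dots> \<le> (1 + 2 * ?k) * vol E"
    using le k by (intro mult_left_mono) auto
  finally show "vol ?H \<le> (1 + 2 * thin_part_const DIM('a) * s\<^sup>2) * vol E"
    by (simp only: mult.assoc)
qed

lemma halo_set_null:
  assumes "E \<in> lmeasurable" "vol E = 0" "0 < \<alpha>"
  shows "halo_set E \<alpha> = {}"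
proof -
  have "vol (E \<inter> ball c r) \<le> 0" for c r
    using assms(1,2) measure_mono_fmeasurable[of "E \<inter> ball c r" E lebesgue] vol_Int_ball[of E c r] by auto
  moreover have "0 \<le> \<alpha> * vol (ball c r)" for c :: 'a and r
    using assms by simp
  ultimately show ?thesis
    unfolding halo_set_def using order.trans[of "vol (E \<inter> ball _ _)" 0] not_le by blast
qed

section \<open>The Tauberian constant as a real-valued function\<close>

text \<open>The weak type bound makes halos of sets of finite measure finite in measure, so the
  extended quotients are real ones.\<close>

lemma tauberian_constant_eq:
  assumes "0 < \<alpha>"
  shows "tauberian_constant TYPE('n::finite) \<alpha> =
    (SUP E \<in> {E :: (real ^ 'n) set. E \<in> lmeasurable \<and> 0 < vol E}. ennreal (vol (halo_set E \<alpha>) / vol E))"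
proof -
  have *: "E \<in> sets lebesgue \<and> 0 < emeasure lebesgue E \<and> emeasure lebesgue E < \<infinity> \<longleftrightarrow> E \<in> lmeasurable \<and> 0 < vol E"
    for E :: "(real ^ 'n) set"
    by (auto simp: fmeasurable_def emeasure_eq_ennreal_measure top.not_eq_extremum)
  have "emeasure lebesgue {x. maximal_function (indicat_real E) x > ennreal \<alpha>} / emeasure lebesgue E
      = ennreal (vol (halo_set E \<alpha>) / vol E)" if "E \<in> lmeasurable" "0 < vol E" for E :: "(real ^ 'n) set"
    using that assms vol_halo_set_weak_type(1)[OF that(1) assms]
    by (simp add: superlevel_set_eq_halo_set fmeasurableD emeasure_eq_measure2 divide_ennreal)
  then show ?thesis
    unfolding tauberian_constant_def * by (intro SUP_cong) auto
qed

lemma tauberian_constant_leI: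
  assumes "0 < \<alpha>" "\<And>E :: (real ^ 'n) set. \<lbrakk>E \<in> lmeasurable; 0 < vol E\<rbrakk> \<Longrightarrow> vol (halo_set E \<alpha>) \<le> K * vol E"
  shows "tauberian_constant TYPE('n::finite) \<alpha> \<le> ennreal K"
  unfolding tauberian_constant_eq[OF assms(1)] using assms(2)
  by (intro SUP_least ennreal_leI) (auto simp: pos_divide_le_eq)

lemma tauberian_constant_finite:
  assumes "0 < \<alpha>"
  shows "tauberian_constant TYPE('n::finite) \<alpha> < \<infinity>"
proof -
  have "tauberian_constant TYPE('n) \<alpha> \<le> ennreal (5 ^ DIM(real ^ 'n) / \<alpha>)"
    using assms by (intro tauberian_constant_leI vol_halo_set_weak_type)
  then show ?thesis
    using order.strict_trans1 by fastforce
qed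

text \<open>The conversion would turn an infinite value into 0;
  \<open>tauberian_constant_finite\<close> excludes this for positive \<alpha>.\<close>

abbreviation tau :: "'n::finite itself \<Rightarrow> real \<Rightarrow> real" where
  "tau N \<alpha> \<equiv> enn2real (tauberian_constant N \<alpha>)"

lemma tau_leI:
  assumes "0 < \<alpha>" "0 \<le> K" "\<And>E :: (real ^ 'n) set. \<lbrakk>E \<in> lmeasurable; 0 < vol E\<rbrakk> \<Longrightarrow> vol (halo_set E \<alpha>) \<le> K * vol E"
  shows "tau TYPE('n::finite) \<alpha> \<le> K"
  using tauberian_constant_leI[OF assms(1,3)] assms(2) enn2real_leI by auto

lemma vol_halo_set_le_tau:
  fixes E :: "(real ^ 'n::finite) set"
  assumes "0 < \<alpha>" "E \<in> lmeasurable"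
  shows "vol (halo_set E \<alpha>) \<le> tau TYPE('n) \<alpha> * vol E"
proof (cases "vol E = 0")
  case True
  then show ?thesis
    using halo_set_null[OF assms(2) True assms(1)] by simp
next
  case False
  then have pos: "0 < vol E" by (simp add: zero_less_measure_iff)
  then have "ennreal (vol (halo_set E \<alpha>) / vol E) \<le> tauberian_constant TYPE('n) \<alpha>"
    unfolding tauberian_constant_eq[OF assms(1)] using assms(2) by (intro SUP_upper) auto
  also have "\<dots> = ennreal (tau TYPE('n) \<alpha>)"
    using tauberian_constant_finite[OF assms(1), where 'n = 'n] by (simp add: ennreal_enn2real)
  finally have "vol (halo_set E \<alpha>) / vol E \<le> tau TYPE('n) \<alpha>"
    by (subst (asm) ennreal_le_iff) auto
  then show ?thesis
    using pos by (simp add: pos_divide_le_eq)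
qed

lemma tau_antimono:
  assumes "0 < \<alpha>" "\<alpha> \<le> \<beta>"
  shows "tau TYPE('n::finite) \<beta> \<le> tau TYPE('n) \<alpha>"
proof (rule tau_leI)
  fix E :: "(real ^ 'n) set" assume E: "E \<in> lmeasurable" "0 < vol E"
  have "halo_set E \<beta> \<subseteq> halo_set E \<alpha>"
  proof
    fix x assume "x \<in> halo_set E \<beta>"
    then obtain c r where x: "x \<in> ball c r" "0 < r" "\<beta> * vol (ball c r) < vol (E \<inter> ball c r)"
      unfolding halo_set_def by blast
    have "\<alpha> * vol (ball c r) \<le> \<beta> * vol (ball c r)"
      using assms(2) by (intro mult_right_mono measure_nonneg)
    then show "x \<in> halo_set E \<alpha>"
      unfolding halo_set_def using x le_less_trans by blast
  qed
  then have "vol (halo_set E \<beta>) \<le> vol (halo_set E \<alpha>)"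
    using E assms vol_halo_set_weak_type(1) by (intro measure_mono_fmeasurable) (auto simp: fmeasurableD)
  then show "vol (halo_set E \<beta>) \<le> tau TYPE('n) \<alpha> * vol E"
    using vol_halo_set_le_tau[OF assms(1) E(1)] by linarith
qed (use assms in auto)

lemma tau_Solyanik:
  assumes "0 < s" "s < 1" "thin_part_const CARD('n) * s\<^sup>2 \<le> 1 / 2"
  shows "tau TYPE('n::finite) (1 - s ^ (CARD('n) + 1)) \<le> 1 + 2 * thin_part_const CARD('n) * s\<^sup>2"
proof (rule tau_leI)
  show "0 < 1 - s ^ (CARD('n) + 1)"
    using assms power_Suc_less_one[of s] by simp
  show "0 \<le> 1 + 2 * thin_part_const CARD('n) * s\<^sup>2"
    unfolding thin_part_const_def by simp
  show "vol (halo_set E (1 - s ^ (CARD('n) + 1))) \<le> (1 + 2 * thin_part_const CARD('n) * s\<^sup>2) * vol E"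
    if "E \<in> lmeasurable" for E :: "(real ^ 'n) set"
    using vol_halo_set_Solyanik[OF that assms(1,2)] assms(3) by simp
qed

section \<open>Growth of density in the halo\<close>

text \<open>A form of the Lebesgue density theorem, proved by contraction of the outer measure
  \<open>Inf X\<close> of \<open>N\<close>. Inside an open set of nearly minimal volume, disjoint
  thin balls cover \<open>N\<close> up to a null set; as \<open>N \<subseteq> E\<close>, so do their
  traces on \<open>E\<close>, whose total volume is smaller by the factor \<open>l\<close>. Hence
  \<open>Inf X\<close> is at most \<open>l * Inf X\<close>.\<close>

lemma negligible_thin_fine_cover:
  fixes N E :: "'a::euclidean_space set"
  assumes E: "E \<in> sets lebesgue" and N: "N \<subseteq> E" "bounded N" and l: "0 \<le> l" "l < 1"
    and thin: "\<And>x d. \<lbrakk>x \<in> N; 0 < d\<rbrakk> \<Longrightarrow>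
      \<exists>c r. 0 < r \<and> r < d \<and> x \<in> ball c r \<and> vol (E \<inter> ball c r) \<le> l * vol (ball c r)"
  shows "negligible N"
proof -
  define X where "X = {vol T | T. T \<in> lmeasurable \<and> N \<subseteq> T}"
  obtain a R where "N \<subseteq> ball a R"
    using N(2) bounded_subset_ballD by blast
  then have ne: "X \<noteq> {}" unfolding X_def using lmeasurable_ball by blast
  have bdd: "bdd_below X" unfolding X_def by (intro bdd_belowI[of _ 0]) auto
  have contract: "Inf X \<le> l * (vol T + e)" if T: "T \<in> lmeasurable" "N \<subseteq> T" and "0 < e" for T e
  proof -
    obtain U where U: "open U" "T \<subseteq> U" "U - T \<in> lmeasurable" "emeasure lebesgue (U - T) < ennreal e"
      using sets_lebesgue_outer_open[of T e] T(1) \<open>0 < e\<close> by blast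
    have Um: "U \<in> lmeasurable"
      using fmeasurable_Diff_D[OF U(3) T(1) U(2)] .
    have "vol (U - T) \<le> e"
      using U(3,4) \<open>0 < e\<close> by (simp add: emeasure_eq_measure2 ennreal_less_iff)
    moreover have "vol (U - T) = vol U - vol T"
      using Um T(1) U(2) by (intro measurable_measure_Diff) auto
    ultimately have volU: "vol U \<le> vol T + e" by linarith
    define K where "K = {(c, r). 0 < r \<and> ball c r \<subseteq> U \<and> vol (E \<inter> ball c r) \<le> l * vol (ball c r)}"
    have fine: "\<exists>i. i \<in> K \<and> x \<in> ball (fst i) (snd i) \<and> snd i < d" if x: "x \<in> N" "0 < d" for x d
    proof -
      obtain e' where e': "0 < e'" "ball x e' \<subseteq> U"
        using U(1,2) T(2) x(1) openE by blast
      have "0 < min d (e' / 2)" using x(2) e'(1) by simp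
      from thin[OF x(1) this]
      obtain c r where cr: "0 < r" "r < min d (e' / 2)" "x \<in> ball c r" "vol (E \<inter> ball c r) \<le> l * vol (ball c r)"
        by blast
      have "ball c r \<subseteq> ball x e'"
        unfolding ball_subset_ball_iff using cr(2,3) unfolding mem_ball by linarith
      then show ?thesis
        using cr e'(2) by (intro exI[of _ "(c, r)"]) (auto simp: K_def)
    qed
    obtain C where C: "countable C" "C \<subseteq> K"
      "pairwise (\<lambda>i j. disjnt (ball (fst i) (snd i)) (ball (fst j) (snd j))) C"
      "negligible (N - (\<Union>i\<in>C. ball (fst i) (snd i)))"
      using Vitali_covering_theorem_balls[of N K fst snd, OF fine] by blast
    define T' where "T' = (\<Union>i\<in>C. E \<inter> ball (fst i) (snd i))"
    have EB: "E \<inter> ball (fst i) (snd i) \<in> lmeasurable" for i :: "'a \<times> real"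
      using vol_Int_ball(1)[OF E] .
    have fin: "vol (\<Union>i\<in>F. E \<inter> ball (fst i) (snd i)) \<le> l * vol U" if F: "F \<subseteq> C" "finite F" for F
    proof -
      have "vol (\<Union>i\<in>F. E \<inter> ball (fst i) (snd i)) \<le> (\<Sum>i\<in>F. vol (E \<inter> ball (fst i) (snd i)))"
        using F EB by (intro measure_UNION_le) auto
      also have "\<dots> \<le> (\<Sum>i\<in>F. l * vol (ball (fst i) (snd i)))"
        using F(1) C(2) by (intro sum_mono) (unfold K_def case_prod_beta, blast)
      also have "\<dots> = l * (\<Sum>i\<in>F. vol (ball (fst i) (snd i)))"
        by (rule sum_distrib_left[symmetric])
      also have "(\<Sum>i\<in>F. vol (ball (fst i) (snd i))) = vol (\<Union>i\<in>F. ball (fst i) (snd i))"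
        using F pairwise_subset[OF C(3) F(1)] by (intro measure_UNION'[symmetric]) auto
      finally have le: "vol (\<Union>i\<in>F. E \<inter> ball (fst i) (snd i)) \<le> l * vol (\<Union>i\<in>F. ball (fst i) (snd i))" .
      have "(\<Union>i\<in>F. ball (fst i) (snd i)) \<subseteq> U"
        using F(1) C(2) unfolding K_def case_prod_beta by blast
      then have "l * vol (\<Union>i\<in>F. ball (fst i) (snd i)) \<le> l * vol U"
        using F(2) Um l by (intro mult_left_mono measure_mono_fmeasurable sets.finite_UN) auto
      with le show ?thesis by linarith
    qed
    have T': "T' \<in> lmeasurable" "vol T' \<le> l * vol U"
      unfolding T'_def using fmeasurable_UN_bound[OF C(1) EB fin] measure_UN_bound[OF C(1) EB fin] by blast+
    define T'' where "T'' = T' \<union> (N - (\<Union>i\<in>C. ball (fst i) (snd i)))"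
    have null: "N - (\<Union>i\<in>C. ball (fst i) (snd i)) \<in> lmeasurable" "vol (N - (\<Union>i\<in>C. ball (fst i) (snd i))) = 0"
      using C(4) negligible_iff_measure by auto
    have "vol T'' \<le> l * vol U"
      unfolding T''_def using measure_Un_le[of T' lebesgue, OF _ fmeasurableD[OF null(1)]] null T' by auto
    moreover have "vol T'' \<in> X"
      unfolding X_def T''_def T'_def[symmetric] using T'(1) null(1) N(1) unfolding T'_def by blast
    ultimately have "Inf X \<le> l * vol U"
      using cInf_lower[OF _ bdd] by fastforce
    also have "\<dots> \<le> l * (vol T + e)"
      using volU l by (intro mult_left_mono)
    finally show ?thesis .
  qed
  have Inf_le: "Inf X \<le> l * (Inf X + e)" if "0 < e" for e
  proof -
    obtain v where v: "v \<in> X" "v < Inf X + e / 2"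
      using cInf_lessD[OF ne, of "Inf X + e / 2"] \<open>0 < e\<close> by auto
    then obtain T where "T \<in> lmeasurable" "N \<subseteq> T" "v = vol T"
      unfolding X_def by blast
    then have "Inf X \<le> l * (v + e / 2)"
      using contract[of T "e / 2"] \<open>0 < e\<close> by simp
    also have "\<dots> \<le> l * (Inf X + e)"
      using v l by (intro mult_left_mono) auto
    finally show ?thesis .
  qed
  have "Inf X \<le> 0"
  proof (rule ccontr)
    define e where "e = (1 - l) * Inf X / 2"
    assume "\<not> Inf X \<le> 0"
    then have e: "0 < e" unfolding e_def using l by auto
    have "Inf X \<le> l * Inf X + l * e"
      using Inf_le[OF e] by (simp only: distrib_left)
    moreover have "l * e \<le> 1 * e"
      using l e by (intro mult_right_mono) auto
    moreover have "2 * e = Inf X - l * Inf X"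
      unfolding e_def by (simp add: left_diff_distrib)
    ultimately show False using e by linarith
  qed
  then show ?thesis
    unfolding negligible_outer using cInf_lessD[OF ne] X_def by (auto; smt (verit) mem_Collect_eq)
qed

text \<open>
  A ball containing \<open>x\<close> is joined to small balls containing \<open>x\<close> by the homotheties centred at \<open>x\<close>.
\<close>
lemma exact_density_ball:
  fixes E :: "'a::euclidean_space set"
  assumes E: "E \<in> sets lebesgue" and x: "x \<in> ball a R" and l: "0 \<le> l"
    and low: "vol (E \<inter> ball a R) \<le> l * vol (ball a R)"
    and t: "0 < t" "t \<le> 1" "l * vol (ball (x + t *\<^sub>R (a - x)) (t * R)) \<le> vol (E \<inter> ball (x + t *\<^sub>R (a - x)) (t * R))"
  obtains c r where "0 < r" "x \<in> ball c r" "ball c r \<subseteq> ball a R" "vol (E \<inter> ball c r) = l * vol (ball c r)"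
proof -
  define B where "B u = ball (x + u *\<^sub>R (a - x)) (u * R)" for u
  define p where "p u = ball_vol TYPE('a) * (u * R) ^ DIM('a)" for u
  define g where "g u = vol (E \<inter> B u)" for u
  have R: "0 < R" "dist x a < R"
    using x by (auto simp: dist_commute intro: le_less_trans[OF zero_le_dist])
  have volB: "vol (B u) = p u" if "0 \<le> u" for u
    unfolding B_def p_def using that R by (intro vol_ball) auto
  \<comment> \<open>From \<open>u\<close> to \<open>v\<close> the centre moves by
    \<open>(v - u) * dist x a\<close>, which is at most the growth \<open>(v - u) * R\<close> of the
    radius.\<close>
  have mono: "B u \<subseteq> B v" if "0 \<le> u" "u \<le> v" for u v
  proof -
    have "(x + u *\<^sub>R (a - x)) - (x + v *\<^sub>R (a - x)) = (u - v) *\<^sub>R (a - x)"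
      by (simp add: algebra_simps)
    then have "dist (x + u *\<^sub>R (a - x)) (x + v *\<^sub>R (a - x)) = (v - u) * dist x a"
      using that by (simp add: dist_norm norm_minus_commute)
    also have "\<dots> \<le> (v - u) * R"
      using that R by (intro mult_left_mono) auto
    finally show ?thesis
      unfolding B_def by (simp add: ball_subset_ball_iff algebra_simps)
  qed
  \<comment> \<open>By nesting, the portion of \<open>E\<close> grows no faster than the ball, so
    \<open>g\<close> inherits continuity from the explicit function \<open>p\<close>, and the
    intermediate value theorem applies between \<open>t\<close> and \<open>1\<close>.\<close>
  have diff: "\<bar>g v - g u\<bar> \<le> \<bar>p v - p u\<bar>" if uv: "0 \<le> u" "u \<le> v" for u v
  proof -
    have EB: "E \<inter> B w \<in> lmeasurable" for w
      unfolding B_def using vol_Int_ball(1)[OF E] .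
    have "g u \<le> g v"
      unfolding g_def using mono[OF uv] EB by (intro measure_mono_fmeasurable) auto
    moreover have "g v - g u = vol (E \<inter> B v - E \<inter> B u)"
      unfolding g_def using mono[OF uv] EB by (intro measurable_measure_Diff[symmetric]) auto
    moreover have "\<dots> \<le> vol (B v - B u)"
      using E EB by (intro measure_mono_fmeasurable) (auto simp: B_def)
    moreover have "\<dots> = vol (B v) - vol (B u)"
      using mono[OF uv] by (intro measurable_measure_Diff) (auto simp: B_def)
    ultimately show ?thesis
      using uv by (simp only: volB)
  qed
  have diff': "dist (g v) (g u) \<le> dist (p v) (p u)" if "0 \<le> u" "0 \<le> v" for u v
    using diff[of u v] diff[of v u] that by (cases "u \<le> v") (auto simp: dist_real_def abs_minus_commute)
  have "continuous_on {t..1} p"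
    unfolding p_def by (intro continuous_intros)
  then have "continuous_on {t..1} g"
    unfolding continuous_on_iff using diff' t(1)
    by (meson atLeastAtMost_iff le_less_trans less_imp_le order_trans)
  then have cont: "continuous_on {t..1} (\<lambda>u. g u - l * p u)"
    unfolding p_def by (intro continuous_intros)
  have "B 1 = ball a R" by (simp add: B_def)
  then have "g 1 - l * p 1 \<le> 0"
    using low volB[of 1] by (simp only: g_def)
  moreover have "0 \<le> g t - l * p t"
    using t(3) unfolding volB[OF less_imp_le[OF t(1)], unfolded B_def] g_def B_def by linarith
  ultimately obtain u where u: "t \<le> u" "u \<le> 1" "g u - l * p u = 0"
    using IVT2'[OF _ _ t(2) cont] by blast
  show thesis
  proof
    have u0: "0 \<le> u" using u(1) t(1) by linarith
    show "0 < u * R" using u t R by simp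
    have "(x + u *\<^sub>R (a - x)) - x = u *\<^sub>R (a - x)" by simp
    then have "dist (x + u *\<^sub>R (a - x)) x = u * dist x a"
      using u t by (simp add: dist_norm norm_minus_commute)
    also have "\<dots> < u * R"
      using u t R by (intro mult_strict_left_mono) auto
    finally show "x \<in> ball (x + u *\<^sub>R (a - x)) (u * R)" by simp
    show "ball (x + u *\<^sub>R (a - x)) (u * R) \<subseteq> ball a R"
      using mono[of u 1] u t unfolding B_def by simp
    show "vol (E \<inter> ball (x + u *\<^sub>R (a - x)) (u * R)) = l * vol (ball (x + u *\<^sub>R (a - x)) (u * R))"
      using u(3) unfolding volB[OF u0, unfolded B_def] g_def B_def by linarith
  qed
qed

text \<open>
  Almost every point of \<open>E \<inter> B\<close> lies in a ball inside \<open>B\<close> in which \<open>E\<close> has density exactly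
  \<open>1 - \<delta> / 2\<close>; each such ball belongs to the halo and contributes its share outside \<open>E\<close>.
\<close>
lemma vol_halo_set_Int_ball_ge:
  fixes E :: "'a::euclidean_space set"
  assumes E: "E \<in> lmeasurable" and \<delta>: "0 < \<delta>" "\<delta> < 1"
    and low: "vol (E \<inter> ball a R) \<le> (1 - \<delta> / 2) * vol (ball a R)"
  shows "(1 + \<delta> / (2 * 5 ^ DIM('a))) * vol (E \<inter> ball a R) \<le> vol (halo_set E (1 - \<delta>) \<inter> ball a R)"
proof -
  define l where "l = 1 - \<delta> / 2"
  define H where "H = halo_set E (1 - \<delta>)"
  have l: "0 \<le> l" "l < 1" "1 - \<delta> < l" using \<delta> by (auto simp: l_def)
  have E': "E \<in> sets lebesgue" using E by auto
  define K where "K = {(c, r). 0 < r \<and> r \<le> R \<and> ball c r \<subseteq> ball a R \<and> vol (E \<inter> ball c r) = l * vol (ball c r)}"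
  define S where "S = E \<inter> ball a R \<inter> (\<Union>i\<in>K. ball (fst i) (snd i))"
  define N where "N = E \<inter> ball a R - S"
  have KH: "ball (fst i) (snd i) \<subseteq> H" if "i \<in> K" for i
  proof -
    obtain c r where i: "i = (c, r)" by (cases i)
    have r: "0 < r" "vol (E \<inter> ball c r) = l * vol (ball c r)"
      using that unfolding i K_def by auto
    have "0 < vol (ball c r)" using r(1) by simp
    then have "(1 - \<delta>) * vol (ball c r) < vol (E \<inter> ball c r)"
      unfolding r(2) using l(3) by (intro mult_strict_right_mono)
    then show ?thesis
      unfolding i H_def halo_set_def using r(1) by auto
  qed
  \<comment> \<open>If some homothetic copy of the ball with centre of homothety \<open>y\<close>
    had density at least \<open>l\<close>, an intermediate ball would have density exactly
    \<open>l\<close> and put \<open>y\<close> into \<open>S\<close>. So for \<open>y\<close> in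
    \<open>N\<close> all these copies, however small, have density below \<open>l\<close>.\<close>
  have "negligible N"
  proof (rule negligible_thin_fine_cover[OF E' _ _ l(1,2)])
    show "N \<subseteq> E" "bounded N"
      unfolding N_def using bounded_subset[OF bounded_ball[of a R]] by auto
    fix x d :: real and y :: 'a assume y: "y \<in> N" and d: "0 < d"
    then have yB: "y \<in> ball a R" and yS: "y \<notin> S" and yE: "y \<in> E" by (auto simp: N_def)
    have R: "0 < R" using yB by (auto intro: le_less_trans[OF zero_le_dist])
    define t where "t = min 1 (d / (2 * R))"
    have t: "0 < t" "t \<le> 1" "t * R < d"
    proof -
      have "t * R \<le> d / (2 * R) * R"
        unfolding t_def using R by (intro mult_right_mono) auto
      also have "\<dots> < d" using R d by simp
      finally show "t * R < d" .
    qed (use R d in \<open>auto simp: t_def\<close>)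
    have "\<not> l * vol (ball (y + t *\<^sub>R (a - y)) (t * R)) \<le> vol (E \<inter> ball (y + t *\<^sub>R (a - y)) (t * R))"
    proof
      assume "l * vol (ball (y + t *\<^sub>R (a - y)) (t * R)) \<le> vol (E \<inter> ball (y + t *\<^sub>R (a - y)) (t * R))"
      then obtain c r where cr: "0 < r" "y \<in> ball c r" "ball c r \<subseteq> ball a R" "vol (E \<inter> ball c r) = l * vol (ball c r)"
        using exact_density_ball[OF E' yB l(1) low[folded l_def] t(1,2)] by blast
      have "r \<le> R"
        using cr(1,3) zero_le_dist[of c a] unfolding ball_subset_ball_iff by linarith
      then have "(c, r) \<in> K" using cr by (simp only: K_def mem_Collect_eq case_prod_conv)
      then show False
        using yS yB yE cr(2) unfolding S_def by force
    qed
    moreover have "y \<in> ball (y + t *\<^sub>R (a - y)) (t * R)"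
      using yB t(1) by (simp add: dist_norm norm_minus_commute)
    ultimately show "\<exists>c r. 0 < r \<and> r < d \<and> y \<in> ball c r \<and> vol (E \<inter> ball c r) \<le> l * vol (ball c r)"
      using t R by (intro exI[of _ "y + t *\<^sub>R (a - y)"] exI[of _ "t * R"] conjI mult_pos_pos) linarith+
  qed
  then have N: "N \<in> lmeasurable" "vol N = 0"
    using negligible_iff_measure by auto
  have EB: "E \<inter> ball a R \<in> lmeasurable" using vol_Int_ball(1)[OF E'] .
  have Sm: "S \<in> lmeasurable"
  proof -
    have "S = E \<inter> ball a R - N" unfolding N_def S_def by auto
    then show ?thesis using EB N by auto
  qed
  have volS: "vol (E \<inter> ball a R) \<le> vol S"
  proof -
    have "E \<inter> ball a R = S \<union> N" unfolding N_def S_def by auto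
    then show ?thesis using measure_Un_le[of S lebesgue N] Sm N by auto
  qed
  obtain C where C: "countable C" "C \<subseteq> K"
    "pairwise (\<lambda>i j. disjnt (ball (fst i) (snd i)) (ball (fst j) (snd j))) C"
    "S \<subseteq> (\<Union>i\<in>C. ball (fst i) (5 * snd i))"
  proof (rule Vitali_covering_lemma_balls[of S fst snd K R])
    show "S \<subseteq> (\<Union>i\<in>K. ball (fst i) (snd i))" by (auto simp: S_def)
    show "0 < snd i \<and> snd i \<le> R" if "i \<in> K" for i using that by (auto simp: K_def)
  qed
  \<comment> \<open>The part of the halo gained outside \<open>E\<close>. Each ball of
    \<open>C\<close> misses \<open>E\<close> in the proportion \<open>\<delta> / 2\<close>, and the
    balls dilated by 5 cover \<open>S\<close>, whence the bound \<open>M\<close>.\<close>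
  define G where "G = (\<Union>i\<in>C. ball (fst i) (snd i)) - E"
  have sub: "(\<Union>i\<in>C. ball (fst i) (snd i)) \<subseteq> ball a R" using C(2) unfolding K_def by fastforce
  have Gm: "G \<in> lmeasurable"
    unfolding G_def using sub C(1) E'
    by (intro fmeasurable_Diff fmeasurable_UN[where A = "ball a R"]) auto
  define M where "M = 5 ^ DIM('a) * (2 / \<delta>) * vol G"
  have fin: "vol (\<Union>i\<in>F. ball (fst i) (5 * snd i)) \<le> M" if F: "F \<subseteq> C" "finite F" for F
  proof -
    have K: "0 < snd i" "vol (E \<inter> ball (fst i) (snd i)) = l * vol (ball (fst i) (snd i))" if "i \<in> F" for i
      using that F(1) C(2) unfolding K_def by auto
    have "vol (\<Union>i\<in>F. ball (fst i) (5 * snd i)) \<le> (\<Sum>i\<in>F. vol (ball (fst i) (5 * snd i)))"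
      using F(2) by (intro measure_UNION_le) auto
    also have "\<dots> = (\<Sum>i\<in>F. 5 ^ DIM('a) * (2 / \<delta>) * vol (ball (fst i) (snd i) - E))"
    proof (rule sum.cong[OF refl])
      fix i assume i: "i \<in> F"
      have "vol (ball (fst i) (5 * snd i)) = 5 ^ DIM('a) * vol (ball (fst i) (snd i))"
        using K(1)[OF i] by (simp only: vol_ball less_imp_le mult_nonneg_nonneg zero_le_numeral power_mult_distrib mult.left_commute)
      moreover have "vol (ball (fst i) (snd i) - E) = vol (ball (fst i) (snd i)) - vol (E \<inter> ball (fst i) (snd i))"
        using vol_Int_ball[OF E', of "fst i" "snd i"] measurable_measure_Diff[of "ball (fst i) (snd i)" lebesgue "E \<inter> ball (fst i) (snd i)"]
        by (simp only: lmeasurable_ball fmeasurableD Int_lower2 Diff_Int Diff_cancel Un_empty_right)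
      then have "vol (ball (fst i) (snd i) - E) = \<delta> / 2 * vol (ball (fst i) (snd i))"
        unfolding K(2)[OF i] l_def by (simp only: left_diff_distrib)
      then have "vol (ball (fst i) (snd i)) = 2 / \<delta> * vol (ball (fst i) (snd i) - E)"
        using \<delta>(1) by (simp add: field_simps)
      ultimately show "vol (ball (fst i) (5 * snd i)) = 5 ^ DIM('a) * (2 / \<delta>) * vol (ball (fst i) (snd i) - E)"
        by (simp only: mult.assoc)
    qed
    also have "\<dots> = 5 ^ DIM('a) * (2 / \<delta>) * (\<Sum>i\<in>F. vol (ball (fst i) (snd i) - E))"
      by (rule sum_distrib_left[symmetric])
    also have "(\<Sum>i\<in>F. vol (ball (fst i) (snd i) - E)) = vol (\<Union>i\<in>F. ball (fst i) (snd i) - E)"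
    proof (intro measure_UNION'[symmetric] fmeasurable_Diff lmeasurable_ball E' F(2))
      show "pairwise (\<lambda>i j. disjnt (ball (fst i) (snd i) - E) (ball (fst j) (snd j) - E)) F"
        by (rule pairwise_mono[OF C(3) _ F(1)]) (unfold disjnt_def, blast)
    qed
    also have "5 ^ DIM('a) * (2 / \<delta>) * vol (\<Union>i\<in>F. ball (fst i) (snd i) - E) \<le> M"
      unfolding M_def using F \<delta>(1) E' Gm
      by (intro mult_left_mono measure_mono_fmeasurable sets.finite_UN) (auto simp: G_def)
    finally show ?thesis .
  qed
  have U5: "(\<Union>i\<in>C. ball (fst i) (5 * snd i)) \<in> lmeasurable" "vol (\<Union>i\<in>C. ball (fst i) (5 * snd i)) \<le> M"
    using fmeasurable_UN_bound[OF C(1) lmeasurable_ball fin] measure_UN_bound[OF C(1) lmeasurable_ball fin] by blast+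
  have "vol (E \<inter> ball a R) \<le> M"
    using volS measure_mono_fmeasurable[OF C(4) fmeasurableD[OF Sm] U5(1)] U5(2) by linarith
  then have "\<delta> / (2 * 5 ^ DIM('a)) * vol (E \<inter> ball a R) \<le> \<delta> / (2 * 5 ^ DIM('a)) * M"
    using \<delta>(1) by (intro mult_left_mono) auto
  also have "\<dots> = vol G"
    unfolding M_def using \<delta>(1) by simp
  \<comment> \<open>\<open>S\<close> lies in \<open>E\<close> and \<open>G\<close> outside it, and
    both lie in the halo, so their volumes add.\<close>
  finally have "(1 + \<delta> / (2 * 5 ^ DIM('a))) * vol (E \<inter> ball a R) \<le> vol S + vol G"
    using volS unfolding distrib_right by linarith
  also have "\<dots> = vol (S \<union> G)"
    using Sm Gm by (intro measure_Union[symmetric]) (auto simp: fmeasurable_def S_def G_def)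
  also have "\<dots> \<le> vol (H \<inter> ball a R)"
  proof (intro measure_mono_fmeasurable)
    show "S \<union> G \<subseteq> H \<inter> ball a R"
      using KH sub C(2) unfolding S_def G_def by blast
    show "H \<inter> ball a R \<in> lmeasurable"
      unfolding H_def using vol_Int_ball(1)[of "halo_set E (1 - \<delta>)" a R] open_halo_set[of E "1 - \<delta>"] by simp
  qed (use Sm Gm in auto)
  finally show ?thesis
    unfolding H_def .
qed

text \<open>For a ball in which \<open>E\<close> has density above \<alpha> there are two cases. If
  the density is at most \<open>1 - \<delta> / 2\<close>, passing to the halo multiplies it by at
  least the stated factor. Otherwise the ball itself belongs to the \<open>1 - \<delta>\<close>
  halo, which then has density 1 there, above \<beta>.\<close>

lemma halo_set_subset_iterate:
  fixes E :: "'a::euclidean_space set"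
  assumes E: "E \<in> lmeasurable" and \<delta>: "0 < \<delta>" "\<delta> < 1" and \<alpha>: "0 < \<alpha>"
    and \<beta>: "\<beta> = (1 + \<delta> / (2 * 5 ^ DIM('a))) * \<alpha>" "\<beta> < 1"
  shows "halo_set E \<alpha> \<subseteq> halo_set (halo_set E (1 - \<delta>)) \<beta>"
proof
  fix x assume "x \<in> halo_set E \<alpha>"
  then obtain c r where x: "x \<in> ball c r" "0 < r" "\<alpha> * vol (ball c r) < vol (E \<inter> ball c r)"
    unfolding halo_set_def by blast
  have pos: "0 < vol (ball c r)" using x(2) by simp
  have "\<beta> * vol (ball c r) < vol (halo_set E (1 - \<delta>) \<inter> ball c r)"
  proof (cases "vol (E \<inter> ball c r) \<le> (1 - \<delta> / 2) * vol (ball c r)")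
    case True
    have "0 < 1 + \<delta> / (2 * 5 ^ DIM('a))" using \<delta>(1) by (intro add_pos_pos) auto
    then have "(1 + \<delta> / (2 * 5 ^ DIM('a))) * (\<alpha> * vol (ball c r)) < (1 + \<delta> / (2 * 5 ^ DIM('a))) * vol (E \<inter> ball c r)"
      using x(3) by (intro mult_strict_left_mono)
    also note vol_halo_set_Int_ball_ge[OF E \<delta> True]
    finally show ?thesis unfolding \<beta>(1) by (simp only: mult.assoc)
  next
    case False
    have "(1 - \<delta>) * vol (ball c r) \<le> (1 - \<delta> / 2) * vol (ball c r)"
      using \<delta>(1) by (intro mult_right_mono) auto
    then have "(1 - \<delta>) * vol (ball c r) < vol (E \<inter> ball c r)"
      using False by linarith
    then have "ball c r \<subseteq> halo_set E (1 - \<delta>)"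
      unfolding halo_set_def using x(2) by blast
    then have "halo_set E (1 - \<delta>) \<inter> ball c r = ball c r" by blast
    then show ?thesis
      using mult_strict_right_mono[OF \<beta>(2) pos] by (simp only: mult_1)
  qed
  then show "x \<in> halo_set (halo_set E (1 - \<delta>)) \<beta>"
    unfolding halo_set_def[of "halo_set E (1 - \<delta>)"] using x(1,2) by blast
qed

text \<open>The inclusion of halos composes the two Tauberian bounds. Since \<open>tau\<close> at
  \<open>1 - \<delta>\<close> is close to 1 for small \<delta>, this limits how fast
  \<open>tau\<close> can drop from \<alpha> to \<beta>.\<close>

lemma tau_iterate:
  assumes \<delta>: "0 < \<delta>" "\<delta> < 1" and \<alpha>: "0 < \<alpha>"
    and \<beta>: "\<beta> = (1 + \<delta> / (2 * 5 ^ CARD('n))) * \<alpha>" "\<beta> < 1"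
  shows "tau TYPE('n::finite) \<alpha> \<le> tau TYPE('n) (1 - \<delta>) * tau TYPE('n) \<beta>"
proof (rule tau_leI[OF \<alpha>])
  fix E :: "(real ^ 'n) set" assume E: "E \<in> lmeasurable"
  have \<beta>0: "0 < \<beta>"
    unfolding \<beta> using \<alpha> \<delta> by (intro mult_pos_pos add_pos_pos) auto
  have \<delta>': "0 < 1 - \<delta>" using \<delta> by simp
  note H = vol_halo_set_weak_type(1)[OF E \<delta>']
  have "vol (halo_set E \<alpha>) \<le> vol (halo_set (halo_set E (1 - \<delta>)) \<beta>)"
    using \<beta> vol_halo_set_weak_type(1)[OF E \<alpha>] vol_halo_set_weak_type(1)[OF H \<beta>0]
    by (intro measure_mono_fmeasurable halo_set_subset_iterate E \<delta> \<alpha>) auto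
  also have "\<dots> \<le> tau TYPE('n) \<beta> * vol (halo_set E (1 - \<delta>))"
    by (rule vol_halo_set_le_tau[OF \<beta>0 H])
  also have "\<dots> \<le> tau TYPE('n) \<beta> * (tau TYPE('n) (1 - \<delta>) * vol E)"
    by (intro mult_left_mono vol_halo_set_le_tau \<delta>' E) simp
  finally show "vol (halo_set E \<alpha>) \<le> tau TYPE('n) (1 - \<delta>) * tau TYPE('n) \<beta> * vol E"
    by (simp add: mult_ac)
qed simp

section \<open>Lower bound from the cube\<close>

lemma vol_box_cart:
  fixes a b :: "real ^ 'n::finite"
  assumes "\<And>i. a $ i \<le> b $ i"
  shows "vol (box a b) = (\<Prod>i\<in>UNIV. b $ i - a $ i)" "vol (cbox a b) = (\<Prod>i\<in>UNIV. b $ i - a $ i)"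
proof -
  have "cbox a b \<noteq> {}" using assms by (simp add: interval_ne_empty_cart)
  then show "vol (cbox a b) = (\<Prod>i\<in>UNIV. b $ i - a $ i)"
    using content_cbox_cart[of a b] by simp
  moreover have "vol (box a b) = vol (cbox a b)"
    by (simp add: measure_lborel_box_eq measure_lborel_cbox_eq)
  ultimately show "vol (box a b) = (\<Prod>i\<in>UNIV. b $ i - a $ i)" by simp
qed

lemma prod_single_coordinate:
  fixes k :: "'n::finite" and x y :: real
  shows "(\<Prod>i\<in>UNIV. if i = k then x else y) = x * y ^ (CARD('n) - 1)"
proof -
  have "(\<Prod>i\<in>UNIV. if i = k then x else y) = (if k = k then x else y) * (\<Prod>i\<in>UNIV - {k}. if i = k then x else y)"
    by (rule prod.remove) auto
  also have "(\<Prod>i\<in>UNIV - {k}. if i = k then x else y) = (\<Prod>i\<in>UNIV - {k}. y)"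
    by (intro prod.cong) auto
  finally show ?thesis by (simp add: card_Diff_singleton)
qed

text \<open>Times \<open>q ^ (n + 1)\<close>, this is the volume of a box with one side
  \<open>q\<^sup>2\<close> and the others \<open>2 * q\<close>, relative to a ball of radius
  \<open>1 / 4\<close>.\<close>

definition cap_const :: "nat \<Rightarrow> real" where
  "cap_const n = 2 ^ (n - 1) * 4 ^ n / unit_ball_vol (real n)"

lemma cap_const_pos: "0 < cap_const n"
  unfolding cap_const_def by simp

text \<open>
  A ball of radius \<open>1 / 4\<close> that protrudes by \<open>q\<^sup>2\<close> from a face of the unit cube leaves the cube only in a
  cap of height \<open>q\<^sup>2\<close> and width \<open>q\<close>.
\<close>
lemma vol_halo_set_cube_ge:
  fixes k :: "'n::finite" and q :: real
  assumes q: "0 < q" "q \<le> 1 / 2" and \<alpha>: "0 < \<alpha>" "cap_const CARD('n) * q ^ (CARD('n) + 1) < 1 - \<alpha>"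
  shows "1 + q\<^sup>2 / 2 ^ (CARD('n) - 1) \<le> vol (halo_set (cbox 0 1 :: (real ^ 'n) set) \<alpha>)"
proof -
  define n where "n = CARD('n)"
  have n: "n \<ge> 1" unfolding n_def by (simp add: Suc_leI)
  define E where "E = (cbox 0 1 :: (real ^ 'n) set)"
  define H where "H = halo_set E \<alpha>"
  have "\<alpha> < 1"
    using \<alpha>(2) q(1) cap_const_pos[of "CARD('n)"] by (smt (verit) mult_nonneg_nonneg zero_le_power)
  have q2: "0 < q\<^sup>2" "q\<^sup>2 \<le> 1 / 4"
    using q power_mono[of q "1 / 2" 2] by (auto simp: power2_eq_square)
  have Em: "E \<in> lmeasurable" unfolding E_def by simp
  have Hm: "H \<in> lmeasurable" unfolding H_def using Em \<alpha>(1) by (rule vol_halo_set_weak_type)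
  have cube: "box 0 1 \<subseteq> H"
  proof
    fix x :: "real ^ 'n" assume "x \<in> box 0 1"
    then obtain e where e: "0 < e" "ball x e \<subseteq> box 0 1"
      using open_box openE by blast
    then have "E \<inter> ball x e = ball x e"
      using box_subset_cbox[of 0 1] unfolding E_def by blast
    moreover have "\<alpha> * vol (ball x e) < 1 * vol (ball x e)"
      using e(1) \<open>\<alpha> < 1\<close> by (intro mult_strict_right_mono) auto
    ultimately have "\<alpha> * vol (ball x e) < vol (E \<inter> ball x e)" by simp
    then show "x \<in> H"
      unfolding H_def halo_set_def using e(1) centre_in_ball[of x e] by blast
  qed
  \<comment> \<open>A slab over the middle of the face; the margin \<open>1 / 4\<close> keeps balls
    of that radius from leaving the cube through any face in another direction.\<close>
  define lo where "lo = (\<chi> i. if i = k then 1 else (1 / 4 :: real))"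
  define hi where "hi = (\<chi> i. if i = k then 1 + q\<^sup>2 else (3 / 4 :: real))"
  define S where "S = (box lo hi :: (real ^ 'n) set)"
  have volS: "vol S = q\<^sup>2 / 2 ^ (n - 1)"
  proof -
    have "vol S = (\<Prod>i\<in>UNIV. hi $ i - lo $ i)"
      unfolding S_def using q2 by (intro vol_box_cart) (simp add: lo_def hi_def)
    also have "\<dots> = (\<Prod>i\<in>UNIV. if i = k then q\<^sup>2 else 1 / 2)"
      by (intro prod.cong) (auto simp: lo_def hi_def)
    also have "\<dots> = q\<^sup>2 / 2 ^ (n - 1)"
      unfolding prod_single_coordinate n_def by (simp add: power_one_over)
    finally show ?thesis .
  qed
  have slab: "S \<subseteq> H"
  proof
    fix x assume "x \<in> S"
    then have x: "\<And>i. lo $ i < x $ i" "\<And>i. x $ i < hi $ i"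
      by (auto simp: S_def mem_box_cart)
    have xk: "1 < x $ k" "x $ k < 1 + q\<^sup>2"
      using x[of k] by (auto simp: lo_def hi_def)
    have xi: "1 / 4 < x $ i" "x $ i < 3 / 4" if "i \<noteq> k" for i
      using x[of i] that by (auto simp: lo_def hi_def)
    \<comment> \<open>The ball is centred straight below \<open>x\<close>, and its top is at height
      exactly \<open>1 + q\<^sup>2\<close>.\<close>
    define c where "c = (\<chi> i. if i = k then 3 / 4 + q\<^sup>2 else x $ i)"
    define B where "B = ball c (1 / 4)"
    have "x - c = axis k (x $ k - (3 / 4 + q\<^sup>2))"
      by (auto simp: vec_eq_iff c_def axis_def)
    then have "dist x c = \<bar>x $ k - (3 / 4 + q\<^sup>2)\<bar>"
      unfolding dist_norm by (simp add: norm_eq_sqrt_inner inner_axis_axis)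
    also have "\<dots> < 1 / 4"
      using xk q2 by linarith
    finally have "x \<in> B" by (simp add: B_def dist_commute)
    define u where "u = (\<chi> i. if i = k then 1 else c $ i - q)"
    define v where "v = (\<chi> i. if i = k then 1 + q\<^sup>2 else c $ i + q)"
    have cap: "B - E \<subseteq> cbox u v"
    proof
      fix y assume y: "y \<in> B - E"
      then have d: "dist c y < 1 / 4" by (simp add: B_def)
      have ck: "c $ k = 3 / 4 + q\<^sup>2" by (simp add: c_def)
      have comp: "\<bar>y $ i - c $ i\<bar> < 1 / 4" for i
        using component_le_norm_cart[of "y - c" i] d by (simp add: dist_norm norm_minus_commute)
      have y0: "0 \<le> y $ i \<and> (i \<noteq> k \<longrightarrow> y $ i \<le> 1)" for i
      proof (cases "i = k")
        case True
        have "0 \<le> y $ k" using comp[of k] q2(1) ck by linarith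
        then show ?thesis using True by simp
      next
        case False
        then have "c $ i = x $ i" by (simp add: c_def)
        then show ?thesis using comp[of i] xi[OF False] by linarith
      qed
      have "1 < y $ k"
      proof (rule ccontr)
        assume "\<not> 1 < y $ k"
        then have "y $ i \<le> 1" for i using y0[of i] by (cases "i = k") auto
        then have "y \<in> E" using y0 by (auto simp: E_def mem_box_cart)
        then show False using y by simp
      qed
      moreover have "y $ k < 1 + q\<^sup>2"
        using comp[of k] ck by linarith
      \<comment> \<open>Pythagoras: above the face the vertical offset exceeds
        \<open>1 / 4 - q\<^sup>2\<close>, which leaves less than \<open>q\<^sup>2\<close> for the
        square of a horizontal offset.\<close>
      moreover have "\<bar>y $ i - c $ i\<bar> \<le> q" if "i \<noteq> k" for i
      proof -
        have "(y $ k - c $ k)\<^sup>2 + (y $ i - c $ i)\<^sup>2 = (\<Sum>j\<in>{k, i}. ((y - c) $ j)\<^sup>2)"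
          using that by simp
        also have "\<dots> \<le> (\<Sum>j\<in>UNIV. ((y - c) $ j)\<^sup>2)"
          by (intro sum_mono2) auto
        also have "\<dots> = (norm (y - c))\<^sup>2"
          by (simp add: norm_vec_def L2_set_def sum_nonneg)
        also have "\<dots> \<le> (1 / 4)\<^sup>2"
          using d by (intro power_mono) (auto simp: dist_norm norm_minus_commute)
        finally have "(y $ k - c $ k)\<^sup>2 + (y $ i - c $ i)\<^sup>2 \<le> (1 / 4)\<^sup>2" .
        moreover have "(1 / 4 - q\<^sup>2)\<^sup>2 \<le> (y $ k - c $ k)\<^sup>2"
          using \<open>1 < y $ k\<close> q2 ck by (intro power_mono) auto
        moreover have "(1 / 4 - q\<^sup>2)\<^sup>2 = (1 / 4)\<^sup>2 - q\<^sup>2 / 2 + (q\<^sup>2)\<^sup>2"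
          by (simp add: power2_diff)
        moreover have "0 \<le> (q\<^sup>2)\<^sup>2" by simp
        ultimately have "(y $ i - c $ i)\<^sup>2 \<le> q\<^sup>2"
          using q2 by linarith
        then show ?thesis
          using q(1) abs_le_square_iff[of "y $ i - c $ i" q] by simp
      qed
      then have "c $ i - q \<le> y $ i \<and> y $ i \<le> c $ i + q" if "i \<noteq> k" for i
        using that unfolding abs_le_iff by (simp add: algebra_simps)
      ultimately show "y \<in> cbox u v"
        by (auto simp: mem_box_cart u_def v_def)
    qed
    have volcap: "vol (cbox u v) = 2 ^ (n - 1) * q ^ (n + 1)"
    proof -
      have "vol (cbox u v) = (\<Prod>i\<in>UNIV. v $ i - u $ i)"
        using q by (intro vol_box_cart) (simp add: u_def v_def)
      also have "\<dots> = (\<Prod>i\<in>UNIV. if i = k then q\<^sup>2 else 2 * q)"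
        by (intro prod.cong) (auto simp: u_def v_def)
      also have "\<dots> = 2 ^ (n - 1) * (q\<^sup>2 * q ^ (n - 1))"
        unfolding prod_single_coordinate n_def by (simp add: power_mult_distrib)
      also have "q\<^sup>2 * q ^ (n - 1) = q ^ (n + 1)"
        using n by (simp flip: power_add)
      finally show ?thesis .
    qed
    have volB: "vol B = unit_ball_vol (real n) * (1 / 4) ^ n"
      unfolding B_def n_def using vol_ball[of "1 / 4" c] by simp
    have EB: "E \<inter> B \<in> lmeasurable"
      unfolding B_def using Em vol_Int_ball(1)[of E c "1 / 4"] by blast
    have "vol B \<le> vol ((E \<inter> B) \<union> cbox u v)"
      using cap EB by (intro measure_mono_fmeasurable fmeasurable.Un) (auto simp: B_def)
    also have "\<dots> \<le> vol (E \<inter> B) + vol (cbox u v)"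
      using EB by (intro measure_Un_le) auto
    finally have le: "vol B \<le> vol (E \<inter> B) + vol (cbox u v)" .
    have "unit_ball_vol (real n) \<noteq> 0"
      by (rule less_imp_neq[symmetric]) simp
    then have "vol (cbox u v) = cap_const n * q ^ (n + 1) * vol B"
      unfolding volcap volB cap_const_def by (simp add: power_one_over)
    moreover have "cap_const n * q ^ (n + 1) * vol B < (1 - \<alpha>) * vol B"
      using \<alpha>(2) unfolding n_def by (intro mult_strict_right_mono) (auto simp: B_def)
    ultimately have "\<alpha> * vol B < vol (E \<inter> B)"
      using le unfolding left_diff_distrib by linarith
    then show "x \<in> H"
      unfolding H_def halo_set_def using \<open>x \<in> B\<close> unfolding B_def
      by (intro UnionI[of B] CollectI exI[of _ c] exI[of _ "1 / 4"]) (auto simp: B_def)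
  qed
  have "vol (box 0 1 :: (real ^ 'n) set) = 1"
    by (subst vol_box_cart) auto
  moreover have "box 0 1 \<inter> S = {}"
  proof -
    have "x $ k < 1" if "x \<in> box 0 1" for x :: "real ^ 'n" using that by (simp add: mem_box_cart)
    moreover have "1 < x $ k" if "x \<in> S" for x
      using that by (auto simp: S_def mem_box_cart lo_def dest!: spec[of _ k])
    ultimately show ?thesis by fastforce
  qed
  then have "vol (box 0 1 \<union> S) = vol (box 0 1 :: (real ^ 'n) set) + vol S"
    by (intro measure_Union) (auto simp: S_def emeasure_eq_measure2)
  moreover have "vol (box 0 1 \<union> S) \<le> vol H"
    using cube slab Hm by (intro measure_mono_fmeasurable) (auto simp: S_def)
  ultimately show ?thesis
    using volS unfolding H_def E_def n_def by simp
qed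

lemma tau_lower_bound:
  assumes q: "0 < q" "q \<le> 1 / 2" and \<alpha>: "0 < \<alpha>" "cap_const CARD('n) * q ^ (CARD('n) + 1) < 1 - \<alpha>"
  shows "1 + q\<^sup>2 / 2 ^ (CARD('n) - 1) \<le> tau TYPE('n::finite) \<alpha>"
proof -
  have "vol (cbox 0 1 :: (real ^ 'n) set) = 1"
    by (subst vol_box_cart(2)) auto
  then show ?thesis
    using vol_halo_set_cube_ge[OF assms] vol_halo_set_le_tau[OF \<alpha>(1), of "cbox 0 1 :: (real ^ 'n) set"] by simp
qed

section \<open>Hoelder estimates\<close>

lemma thin_part_const_ge_1: "1 \<le> thin_part_const n"
  unfolding thin_part_const_def by simp

lemma power_Suc_powr:
  assumes "0 < s"
  shows "(s ^ (n + 1)) powr (2 / (real n + 1)) = s\<^sup>2"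
proof -
  have "s ^ (n + 1) = s powr (real n + 1)"
    using assms powr_realpow[OF assms, of "n + 1"] by (simp add: add.commute)
  moreover have "(real n + 1) * (2 / (real n + 1)) = 2"
    by (rule nonzero_mult_div_cancel_left[of "real n + 1" 2, unfolded times_divide_eq_right[symmetric]]) simp
  ultimately show ?thesis
    using assms by (simp only: powr_powr) simp
qed

text \<open>The bound of \<open>tau_Solyanik\<close> in the variable
  \<open>\<delta> = s ^ (n + 1)\<close>, for which \<open>s\<^sup>2\<close> is
  \<open>\<delta> powr \<rho>\<close>.\<close>

lemma tau_upper_bound:
  assumes \<rho>: "\<rho> = 2 / (real CARD('n) + 1)"
  shows "\<exists>\<delta>\<^sub>0>0. \<delta>\<^sub>0 < 1 \<and> (\<forall>\<delta>. 0 < \<delta> \<and> \<delta> \<le> \<delta>\<^sub>0 \<longrightarrow>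
      tau TYPE('n::finite) (1 - \<delta>) \<le> 1 + 2 * thin_part_const CARD('n) * \<delta> powr \<rho>)"
proof -
  define n where "n = CARD('n)"
  define k where "k = thin_part_const n"
  \<comment> \<open>As \<open>s\<^sub>0 < 1\<close>, any \<open>s \<le> s\<^sub>0\<close> gives
    \<open>k * s\<^sup>2 \<le> k * s\<^sub>0 = 1 / 2\<close>.\<close>
  define s\<^sub>0 where "s\<^sub>0 = 1 / (2 * k)"
  have k: "1 \<le> k" unfolding k_def by (rule thin_part_const_ge_1)
  have s0: "0 < s\<^sub>0" "s\<^sub>0 < 1" unfolding s\<^sub>0_def using k by auto
  have "tau TYPE('n) (1 - \<delta>) \<le> 1 + 2 * thin_part_const CARD('n) * \<delta> powr \<rho>"
    if \<delta>: "0 < \<delta>" "\<delta> \<le> s\<^sub>0 ^ (n + 1)" for \<delta>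
  proof -
    define s where "s = root (n + 1) \<delta>"
    have s: "0 < s" "s ^ (n + 1) = \<delta>"
      unfolding s_def using \<delta>(1) by (auto simp del: power_Suc)
    have "s \<le> s\<^sub>0"
      using s \<delta>(2) s0 power_le_imp_le_base[of s n s\<^sub>0] by simp
    have "k * s\<^sup>2 \<le> k * (s\<^sub>0 * 1)"
      unfolding power2_eq_square using s \<open>s \<le> s\<^sub>0\<close> s0 k by (intro mult_left_mono mult_mono) auto
    also have "\<dots> = 1 / 2" unfolding s\<^sub>0_def using k by simp
    finally have "tau TYPE('n) (1 - s ^ (n + 1)) \<le> 1 + 2 * k * s\<^sup>2"
      unfolding n_def k_def using s \<open>s \<le> s\<^sub>0\<close> s0 by (intro tau_Solyanik) auto
    moreover have "\<delta> powr \<rho> = s\<^sup>2"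
      unfolding \<rho> n_def[symmetric] s(2)[symmetric] by (rule power_Suc_powr[OF s(1)])
    ultimately show ?thesis
      using s(2) by (simp only: k_def n_def)
  qed
  moreover have "0 < s\<^sub>0 ^ (n + 1)" "s\<^sub>0 ^ (n + 1) < 1"
    using s0 power_Suc_less_one[of s\<^sub>0 n] by auto
  ultimately show ?thesis by blast
qed

text \<open>For \<alpha> < \<beta> the number \<delta> is chosen so that \<beta> is the level
  reached from \<alpha> by one iteration. For small \<delta> the iteration bounds the drop of
  \<open>tau\<close>; for larger \<delta> the trivial bound by \<open>A\<close>, the value at the
  left endpoint, is enough.\<close>

lemma tau_Hoelder:
  assumes \<rho>: "\<rho> = 2 / (real CARD('n) + 1)" and ab: "0 < a" "b < 1"
  shows "\<exists>C\<ge>0. \<forall>\<alpha>\<in>{a..b}. \<forall>\<beta>\<in>{a..b}.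
    \<bar>tau TYPE('n::finite) \<alpha> - tau TYPE('n) \<beta>\<bar> \<le> C * \<bar>\<alpha> - \<beta>\<bar> powr \<rho>"
proof -
  define n where "n = CARD('n)"
  define k where "k = thin_part_const n"
  define \<kappa> where "\<kappa> = 1 / (2 * 5 ^ n :: real)"
  define A where "A = tau TYPE('n) a"
  have k: "1 \<le> k" unfolding k_def by (rule thin_part_const_ge_1)
  have \<kappa>: "0 < \<kappa>" unfolding \<kappa>_def by simp
  have \<rho>0: "0 < \<rho>" unfolding \<rho> by simp
  obtain \<delta>\<^sub>0 where \<delta>0: "0 < \<delta>\<^sub>0" "\<delta>\<^sub>0 < 1"
    "\<And>\<delta>. \<lbrakk>0 < \<delta>; \<delta> \<le> \<delta>\<^sub>0\<rbrakk> \<Longrightarrow> tau TYPE('n) (1 - \<delta>) \<le> 1 + 2 * k * \<delta> powr \<rho>"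
    using tau_upper_bound[OF \<rho>] unfolding k_def n_def by blast
  \<comment> \<open>The first summand serves the iteration case, the second makes
    \<open>L * d powr \<rho>\<close> at least 1 when \<open>\<delta>\<close> exceeds
    \<open>\<delta>\<^sub>0\<close>.\<close>
  define L where "L = 2 * k + 1 / \<delta>\<^sub>0 powr \<rho>"
  define C where "C = A * L * (1 / (\<kappa> * a)) powr \<rho>"
  have A0: "0 \<le> A" and L: "2 * k \<le> L" "1 / \<delta>\<^sub>0 powr \<rho> \<le> L" "0 \<le> L"
    unfolding A_def L_def using k by auto
  have C0: "0 \<le> C" unfolding C_def using A0 L by simp
  have main: "\<bar>tau TYPE('n) \<alpha> - tau TYPE('n) \<beta>\<bar> \<le> C * \<bar>\<alpha> - \<beta>\<bar> powr \<rho>"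
    if le: "\<alpha> < \<beta>" "a \<le> \<alpha>" "\<beta> \<le> b" for \<alpha> \<beta>
  proof -
    define \<delta> where "\<delta> = (\<beta> - \<alpha>) / (\<kappa> * \<alpha>)"
    define d where "d = (\<beta> - \<alpha>) / (\<kappa> * a)"
    have \<alpha>0: "0 < \<alpha>" using ab le by simp
    have \<delta>: "0 < \<delta>" unfolding \<delta>_def using le \<kappa> \<alpha>0 by simp
    have d: "\<delta> \<le> d" unfolding \<delta>_def d_def using le \<kappa> ab by (intro divide_left_mono mult_left_mono mult_pos_pos) auto
    have dC: "A * L * d powr \<rho> = C * \<bar>\<alpha> - \<beta>\<bar> powr \<rho>"
    proof -
      have "d powr \<rho> = (1 / (\<kappa> * a)) powr \<rho> * (\<beta> - \<alpha>) powr \<rho>"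
        unfolding d_def using le \<kappa> ab by (simp flip: powr_mult)
      then show ?thesis
        unfolding C_def using le by (simp add: abs_minus_commute)
    qed
    have anti: "tau TYPE('n) \<beta> \<le> tau TYPE('n) \<alpha>" "tau TYPE('n) \<alpha> \<le> A" "tau TYPE('n) \<beta> \<le> A"
      unfolding A_def using le ab by (auto intro!: tau_antimono)
    have "tau TYPE('n) \<alpha> - tau TYPE('n) \<beta> \<le> A * (L * d powr \<rho>)"
    proof (cases "\<delta> \<le> \<delta>\<^sub>0")
      case True
      have "\<beta> = (1 + \<delta> / (2 * 5 ^ CARD('n))) * \<alpha>"
      proof -
        have "\<delta> * \<kappa> * \<alpha> = \<beta> - \<alpha>" unfolding \<delta>_def using \<kappa> \<alpha>0 by simp
        then show ?thesis unfolding \<kappa>_def n_def by (simp add: algebra_simps)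
      qed
      then have "tau TYPE('n) \<alpha> \<le> tau TYPE('n) (1 - \<delta>) * tau TYPE('n) \<beta>"
        using \<delta> True \<delta>0(2) \<alpha>0 le ab by (intro tau_iterate) auto
      also have "\<dots> \<le> (1 + 2 * k * \<delta> powr \<rho>) * tau TYPE('n) \<beta>"
        using \<delta>0(3)[OF \<delta> True] by (intro mult_right_mono) auto
      finally have "tau TYPE('n) \<alpha> - tau TYPE('n) \<beta> \<le> (2 * k * \<delta> powr \<rho>) * tau TYPE('n) \<beta>"
        by (simp add: distrib_right)
      also have "\<dots> \<le> (L * d powr \<rho>) * A"
        using anti L k \<delta> d \<rho>0 by (intro mult_mono powr_mono2 mult_nonneg_nonneg) auto
      finally show ?thesis by (simp add: mult.commute)
    next
      case False
      have "1 = 1 / \<delta>\<^sub>0 powr \<rho> * \<delta>\<^sub>0 powr \<rho>" using \<delta>0(1) by simp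
      also have "\<dots> \<le> L * d powr \<rho>"
        using L False d \<delta>0(1) \<rho>0 by (intro mult_mono powr_mono2) auto
      finally have "A * 1 \<le> A * (L * d powr \<rho>)"
        using A0 by (intro mult_left_mono)
      moreover have "0 \<le> tau TYPE('n) \<beta>" by simp
      ultimately show ?thesis using anti by linarith
    qed
    then show ?thesis
      using anti dC by (simp only: mult.assoc)
  qed
  have "\<bar>tau TYPE('n) \<alpha> - tau TYPE('n) \<beta>\<bar> \<le> C * \<bar>\<alpha> - \<beta>\<bar> powr \<rho>" if "\<alpha> \<in> {a..b}" "\<beta> \<in> {a..b}" for \<alpha> \<beta>
    using main[of \<alpha> \<beta>] main[of \<beta> \<alpha>] that C0
    by (cases \<alpha> \<beta> rule: linorder_cases) (auto simp: abs_minus_commute)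
  then show ?thesis using C0 by blast
qed

section \<open>The halo function near 1\<close>

lemma halo_function_eq_tau:
  assumes "1 < t"
  shows "halo_function TYPE('n::finite) t = tauberian_constant TYPE('n) (1 / t)"
  using assms by (simp add: halo_function_def)

lemma halo_function_upper:
  assumes \<rho>: "\<rho> = 2 / (real CARD('n) + 1)"
  shows "\<exists>h\<^sub>0>0. \<forall>h. 0 < h \<and> h < h\<^sub>0 \<longrightarrow>
    enn2real (halo_function TYPE('n::finite) (1 + h)) - 1 \<le> 2 * thin_part_const CARD('n) * h powr \<rho>"
proof -
  obtain \<delta>\<^sub>0 where \<delta>0: "0 < \<delta>\<^sub>0" "\<And>\<delta>. \<lbrakk>0 < \<delta>; \<delta> \<le> \<delta>\<^sub>0\<rbrakk> \<Longrightarrow>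
      tau TYPE('n) (1 - \<delta>) \<le> 1 + 2 * thin_part_const CARD('n) * \<delta> powr \<rho>"
    using tau_upper_bound[OF \<rho>] by blast
  have "enn2real (halo_function TYPE('n) (1 + h)) - 1 \<le> 2 * thin_part_const CARD('n) * h powr \<rho>"
    if h: "0 < h" "h < \<delta>\<^sub>0" for h
  proof -
    define \<delta> where "\<delta> = h / (1 + h)"
    have \<delta>: "0 < \<delta>" "\<delta> \<le> h" "1 / (1 + h) = 1 - \<delta>"
      unfolding \<delta>_def using h by (auto simp: field_simps)
    have "\<delta> powr \<rho> \<le> h powr \<rho>"
      using \<delta> by (intro powr_mono2) (auto simp: \<rho>)
    then have "2 * thin_part_const CARD('n) * \<delta> powr \<rho> \<le> 2 * thin_part_const CARD('n) * h powr \<rho>"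
      using thin_part_const_ge_1[of "CARD('n)"] by (intro mult_left_mono) auto
    moreover have "enn2real (halo_function TYPE('n) (1 + h)) = tau TYPE('n) (1 - \<delta>)"
      using h \<delta>(3) by (simp only: halo_function_eq_tau less_add_same_cancel1)
    ultimately show ?thesis
      using \<delta>0(2)[of \<delta>] \<delta> h by linarith
  qed
  then show ?thesis using \<delta>0(1) by blast
qed

lemma halo_function_lower:
  assumes \<rho>: "\<rho> = 2 / (real CARD('n) + 1)"
  shows "\<exists>c>0. \<exists>h\<^sub>0>0. \<forall>h. 0 < h \<and> h < h\<^sub>0 \<longrightarrow>
    c * h powr \<rho> \<le> enn2real (halo_function TYPE('n::finite) (1 + h)) - 1"
proof -
  define n where "n = CARD('n)"
  define M where "M = cap_const n"
  have M: "0 < M" unfolding M_def by (rule cap_const_pos)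
  define c where "c = (1 / (4 * M)) powr \<rho> / 2 ^ (n - 1)"
  \<comment> \<open>The first bound gives \<open>h / 2 \<le> h / (1 + h)\<close>, the second gives
    \<open>q \<le> 1 / 2\<close>.\<close>
  define h\<^sub>0 where "h\<^sub>0 = min 1 (4 * M * (1 / 2) ^ (n + 1))"
  have "c * h powr \<rho> \<le> enn2real (halo_function TYPE('n) (1 + h)) - 1" if h: "0 < h" "h < h\<^sub>0" for h
  proof -
    have h1: "h < 1" "h < 4 * M * (1 / 2) ^ (n + 1)" using h unfolding h\<^sub>0_def by auto
    \<comment> \<open>Then \<open>M * q ^ (n + 1)\<close> is \<open>h / 4\<close>, strictly below
      \<open>1 - 1 / (1 + h)\<close>, as the cube estimate demands.\<close>
    define q where "q = root (n + 1) (h / (4 * M))"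
    have q: "0 < q" "q ^ (n + 1) = h / (4 * M)"
      unfolding q_def using h M by (auto simp del: power_Suc)
    have "q ^ (n + 1) \<le> (1 / 2) ^ (n + 1)"
      unfolding q(2) using h1 M by (simp add: pos_divide_le_eq mult.commute)
    then have q2: "q \<le> 1 / 2"
      using power_le_imp_le_base[of q n "1 / 2"] by simp
    have "M * q ^ (n + 1) = h / 4"
      unfolding q(2) using M by simp
    also have "\<dots> < h / 2" using h by simp
    also have "\<dots> \<le> h / (1 + h)"
      using h h1 by (intro divide_left_mono) auto
    also have "\<dots> = 1 - 1 / (1 + h)"
      using h by (simp add: field_simps)
    finally have "1 + q\<^sup>2 / 2 ^ (n - 1) \<le> tau TYPE('n) (1 / (1 + h))"
      unfolding M_def n_def using q(1) q2 h by (intro tau_lower_bound) auto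
    moreover have "q\<^sup>2 / 2 ^ (n - 1) = c * h powr \<rho>"
    proof -
      have "q\<^sup>2 = (q ^ (n + 1)) powr \<rho>"
        unfolding \<rho> n_def[symmetric] by (rule power_Suc_powr[OF q(1), symmetric])
      also have "\<dots> = (1 / (4 * M) * h) powr \<rho>"
        unfolding q(2) by simp
      also have "\<dots> = (1 / (4 * M)) powr \<rho> * h powr \<rho>"
        by (rule powr_mult)
      finally show ?thesis unfolding c_def by simp
    qed
    ultimately show ?thesis
      using h by (simp only: halo_function_eq_tau less_add_same_cancel1)
  qed
  moreover have "0 < c" "0 < h\<^sub>0" unfolding c_def h\<^sub>0_def using M by auto
  ultimately show ?thesis by blast
qed

theorem corollary3p2:
  fixes \<rho> :: real
  assumes "CARD('n::finite) \<ge> 2"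
    and "\<rho> = 2 / (real CARD('n) + 1)"
  shows "locally_holder_on \<rho> {0<..<1} (tauberian_constant TYPE('n))
    \<and> locally_holder_on \<rho> {1<..} (halo_function TYPE('n))
    \<and> (\<exists>c>0. \<exists>C>0. \<exists>h\<^sub>0>0. \<forall>h. 0 < h \<and> h < h\<^sub>0 \<longrightarrow>
          c * h powr \<rho> \<le> enn2real (halo_function TYPE('n) (1 + h)) - 1 \<and>
          enn2real (halo_function TYPE('n) (1 + h)) - 1 \<le> C * h powr \<rho>)
    \<and> (\<forall>\<gamma>>\<rho>. \<not> (\<exists>C>0. \<exists>\<epsilon>>0. \<forall>t\<ge>0. \<bar>t - 1\<bar> < \<epsilon> \<longrightarrow>
          \<bar>enn2real (halo_function TYPE('n) t) - enn2real (halo_function TYPE('n) 1)\<bar>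
            \<le> C * \<bar>t - 1\<bar> powr \<gamma>))"
proof (intro conjI)
  note \<rho> = assms(2)
  have \<rho>0: "0 < \<rho>" unfolding \<rho> by simp
  show "locally_holder_on \<rho> {0<..<1} (tauberian_constant TYPE('n))"
    unfolding locally_holder_on_def
  proof (intro allI impI)
    fix a b :: real assume sub: "{a..b} \<subseteq> {0<..<1}"
    show "(\<forall>t\<in>{a..b}. tauberian_constant TYPE('n) t < \<infinity>) \<and>
        (\<exists>C. \<forall>s\<in>{a..b}. \<forall>t\<in>{a..b}. \<bar>tau TYPE('n) s - tau TYPE('n) t\<bar> \<le> C * \<bar>s - t\<bar> powr \<rho>)"
    proof (cases "a \<le> b")
      case True
      then have "0 < a" "b < 1" using sub by auto
      then show ?thesis
        using tau_Hoelder[OF \<rho>, of a b] tauberian_constant_finite[where 'n = 'n] sub by fastforce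
    qed auto
  qed
  show "locally_holder_on \<rho> {1<..} (halo_function TYPE('n))"
    unfolding locally_holder_on_def
  proof (intro allI impI)
    fix a b :: real assume sub: "{a..b} \<subseteq> {1<..}"
    show "(\<forall>t\<in>{a..b}. halo_function TYPE('n) t < \<infinity>) \<and>
        (\<exists>C. \<forall>s\<in>{a..b}. \<forall>t\<in>{a..b}.
          \<bar>enn2real (halo_function TYPE('n) s) - enn2real (halo_function TYPE('n) t)\<bar> \<le> C * \<bar>s - t\<bar> powr \<rho>)"
    proof (cases "a \<le> b")
      case True
      then have a: "1 < a" using sub by auto
      \<comment> \<open>Inversion maps \<open>{a..b}\<close> into \<open>{1 / b..1 / a}\<close> and
        is 1-Lipschitz above 1, so the constant found for \<open>tau\<close> carries over.\<close>
      obtain C where C: "0 \<le> C" "\<And>s t. \<lbrakk>s \<in> {1 / b..1 / a}; t \<in> {1 / b..1 / a}\<rbrakk> \<Longrightarrow>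
          \<bar>tau TYPE('n) s - tau TYPE('n) t\<bar> \<le> C * \<bar>s - t\<bar> powr \<rho>"
        using tau_Hoelder[OF \<rho>, of "1 / b" "1 / a"] a True by auto
      have "\<bar>enn2real (halo_function TYPE('n) s) - enn2real (halo_function TYPE('n) t)\<bar> \<le> C * \<bar>s - t\<bar> powr \<rho>"
        if st: "s \<in> {a..b}" "t \<in> {a..b}" for s t
      proof -
        have 1: "1 < s" "1 < t" using st a by auto
        have "1 / s - 1 / t = (t - s) / (s * t)"
          using 1 by (simp add: field_simps)
        then have "\<bar>1 / s - 1 / t\<bar> = \<bar>s - t\<bar> / (s * t)"
          using 1 by (simp add: abs_mult abs_minus_commute)
        also have "\<dots> \<le> \<bar>s - t\<bar> / 1"
          using 1 less_1_mult[of s t] by (intro divide_left_mono) auto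
        finally have "\<bar>1 / s - 1 / t\<bar> powr \<rho> \<le> \<bar>s - t\<bar> powr \<rho>"
          using \<rho>0 by (intro powr_mono2) auto
        then have "C * \<bar>1 / s - 1 / t\<bar> powr \<rho> \<le> C * \<bar>s - t\<bar> powr \<rho>"
          using C(1) by (intro mult_left_mono)
        moreover have "\<bar>tau TYPE('n) (1 / s) - tau TYPE('n) (1 / t)\<bar> \<le> C * \<bar>1 / s - 1 / t\<bar> powr \<rho>"
          using st a by (intro C(2)) (auto intro!: divide_left_mono)
        ultimately show ?thesis
          unfolding halo_function_eq_tau[OF 1(1)] halo_function_eq_tau[OF 1(2)] by linarith
      qed
      moreover have "halo_function TYPE('n) t < \<infinity>" if "t \<in> {a..b}" for t
        using that a tauberian_constant_finite[of "1 / t", where 'n = 'n] by (simp add: halo_function_eq_tau)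
      ultimately show ?thesis by blast
    qed auto
  qed
  obtain c h\<^sub>1 where c: "0 < c" "0 < h\<^sub>1"
    "\<And>h. \<lbrakk>0 < h; h < h\<^sub>1\<rbrakk> \<Longrightarrow> c * h powr \<rho> \<le> enn2real (halo_function TYPE('n) (1 + h)) - 1"
    using halo_function_lower[OF \<rho>] by blast
  obtain h\<^sub>2 where h2: "0 < h\<^sub>2"
    "\<And>h. \<lbrakk>0 < h; h < h\<^sub>2\<rbrakk> \<Longrightarrow> enn2real (halo_function TYPE('n) (1 + h)) - 1 \<le> 2 * thin_part_const CARD('n) * h powr \<rho>"
    using halo_function_upper[OF \<rho>] by blast
  show "\<exists>c>0. \<exists>C>0. \<exists>h\<^sub>0>0. \<forall>h. 0 < h \<and> h < h\<^sub>0 \<longrightarrow>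
          c * h powr \<rho> \<le> enn2real (halo_function TYPE('n) (1 + h)) - 1 \<and>
          enn2real (halo_function TYPE('n) (1 + h)) - 1 \<le> C * h powr \<rho>"
    using c h2 thin_part_const_ge_1[of "CARD('n)"]
    by (intro exI[of _ c] exI[of _ "2 * thin_part_const CARD('n)"] exI[of _ "min h\<^sub>1 h\<^sub>2"] conjI allI impI) auto
  show "\<forall>\<gamma>>\<rho>. \<not> (\<exists>C>0. \<exists>\<epsilon>>0. \<forall>t\<ge>0. \<bar>t - 1\<bar> < \<epsilon> \<longrightarrow>
          \<bar>enn2real (halo_function TYPE('n) t) - enn2real (halo_function TYPE('n) 1)\<bar>
            \<le> C * \<bar>t - 1\<bar> powr \<gamma>)"
  proof (intro allI impI notI)
    fix \<gamma> assume \<gamma>: "\<rho> < \<gamma>"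
    assume "\<exists>C>0. \<exists>\<epsilon>>0. \<forall>t\<ge>0. \<bar>t - 1\<bar> < \<epsilon> \<longrightarrow>
          \<bar>enn2real (halo_function TYPE('n) t) - enn2real (halo_function TYPE('n) 1)\<bar>
            \<le> C * \<bar>t - 1\<bar> powr \<gamma>"
    then obtain C \<epsilon> where C: "0 < C" "0 < \<epsilon>" "\<And>t. \<lbrakk>0 \<le> t; \<bar>t - 1\<bar> < \<epsilon>\<rbrakk> \<Longrightarrow>
        \<bar>enn2real (halo_function TYPE('n) t) - enn2real (halo_function TYPE('n) 1)\<bar> \<le> C * \<bar>t - 1\<bar> powr \<gamma>"
      by blast
    \<comment> \<open>The lower bound and the assumed one give
      \<open>c \<le> C * h powr (\<gamma> - \<rho>)\<close>; with \<open>h\<close> this small the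
      right side is at most \<open>C * x = c / 2\<close>.\<close>
    define x where "x = c / (2 * C)"
    define h where "h = min (min (h\<^sub>1 / 2) (\<epsilon> / 2)) (x powr (1 / (\<gamma> - \<rho>)))"
    have x: "0 < x" unfolding x_def using c C by simp
    have h: "0 < h" "h < h\<^sub>1" "h < \<epsilon>" "h \<le> x powr (1 / (\<gamma> - \<rho>))"
      unfolding h_def using c(2) C(2) x by auto
    have "enn2real (halo_function TYPE('n) 1) = 1"
      by (simp add: halo_function_def)
    then have "c * h powr \<rho> \<le> C * h powr \<gamma>"
      using C(3)[of "1 + h"] c(3)[OF h(1,2)] h by simp
    also have "h powr \<gamma> = h powr \<rho> * h powr (\<gamma> - \<rho>)"
      by (simp flip: powr_add)
    finally have "c * h powr \<rho> \<le> (C * h powr (\<gamma> - \<rho>)) * h powr \<rho>"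
      by (simp only: mult_ac)
    then have "c \<le> C * h powr (\<gamma> - \<rho>)"
      using h(1) by (simp add: mult_le_cancel_right)
    also have "h powr (\<gamma> - \<rho>) \<le> (x powr (1 / (\<gamma> - \<rho>))) powr (\<gamma> - \<rho>)"
      using h \<gamma> by (intro powr_mono2) auto
    also have "\<dots> = x"
      using x \<gamma> by (simp add: powr_powr)
    finally show False
      using C(1) c(1) by (simp add: x_def)
  qed
qed

end
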